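(* Let $f:W\to\mathbb R$ be measurable with $$\int_W(|f|+1)e^{-f}\,d\mu<\infty .$$ Then $$-\log E[e^{-f}]\le\inf\left(E\left[f\circ(I_W+u)+\frac12|u|_H^2\right]:\ u\in L^2_a(\mu,H)\right).$$
   Context: $W=C_0([0,1],\mathbb R^d)$ is the space of continuous paths starting at $0$, $\mu$ is Wiener measure, and $E=E_\mu$. $H$ is the Cameron–Martin space of absolutely continuous $h(t)=\int_0^t\dot h(s)ds$ with $|h|_H^2=\int_0^1|\dot h(s)|^2ds<\infty$. $(\mathcal F_t)_{t\in[0,1]}$ is the $\mu$-completed filtration of the canonical process $W_t(w)=w(t)$. $L^2_a(\mu,H)$ is the set of ($\mu$-classes of) measurable $u:W\to H$, $u(t,w)=\int_0^t\dot u_s(w)ds$, with $E[|u|_H^2]<\infty$ and $\dot u_s$ $\mathcal F_s$-measurable for almost all $s$. $(I_W+u)(w)=w+u(w)$. *)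

theory Defs
  imports "HOL-Probability.Probability"
begin

text \<open>
  Paths are functions \<open>real \<Rightarrow> real ^ 'd\<close> that are \<open>undefined\<close> outside \<open>{0..1}\<close>, as in the
  product space \<open>PiM {0..1} _\<close>. On continuous paths the trace of the product sigma-algebra is the
  Borel sigma-algebra of the uniform topology.
\<close>

definition path_space :: "(real \<Rightarrow> real ^ 'd::finite) measure" where
  "path_space =
     restrict_space (\<Pi>\<^sub>M t\<in>{0..1}. borel) {w. continuous_on {0..1} w \<and> w 0 = 0}"

locale wiener_measure = prob_space \<mu> for \<mu> :: "(real \<Rightarrow> real ^ 'd::finite) measure" +
  assumes sets_eq: "sets \<mu> = sets path_space"
    and indep_increments:
      "\<And>(\<tau> :: nat \<Rightarrow> real) n. mono \<tau> \<Longrightarrow> range \<tau> \<subseteq> {0..1} \<Longrightarrow>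
         indep_vars (\<lambda>_. borel) (\<lambda>i w. w (\<tau> (Suc i)) - w (\<tau> i)) {..<n}"
    and gaussian_increments:
      "\<And>s t. 0 \<le> s \<Longrightarrow> s < t \<Longrightarrow> t \<le> 1 \<Longrightarrow>
         distributed \<mu> lborel (\<lambda>w. w t - w s)
           (\<lambda>x. ennreal (\<Prod>i\<in>UNIV. normal_density 0 (sqrt (t - s)) (x $ i)))"

definition completed_filtration ::
    "(real \<Rightarrow> real ^ 'd::finite) measure \<Rightarrow> real \<Rightarrow> (real \<Rightarrow> real ^ 'd) measure" where
  "completed_filtration \<mu> t = sigma (space \<mu>)
     ({{w \<in> space \<mu>. w s \<in> A} | s A. s \<in> {0..t} \<and> A \<in> sets borel} \<union> null_sets (completion \<mu>))"

text \<open>\<open>cm_deriv h g\<close>: \<open>g\<close> is a version of the derivative of \<open>h\<close>, determined almost everywhere.\<close>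

definition cm_deriv :: "(real \<Rightarrow> real ^ 'd::finite) \<Rightarrow> (real \<Rightarrow> real ^ 'd) \<Rightarrow> bool" where
  "cm_deriv h g \<longleftrightarrow>
     set_integrable lborel {0..1} g \<and>
     set_integrable lborel {0..1} (\<lambda>s. (norm (g s))\<^sup>2) \<and>
     (\<forall>t\<in>{0..1}. h t = (LINT s:{0..t}|lborel. g s))"

definition cm_space :: "(real \<Rightarrow> real ^ 'd::finite) set" where
  "cm_space = {h \<in> extensional {0..1}. \<exists>g. cm_deriv h g}"

text \<open>The squared norm; it does not depend on the version of the derivative that is chosen.\<close>

definition cm_norm_sq :: "(real \<Rightarrow> real ^ 'd::finite) \<Rightarrow> real" where
  "cm_norm_sq h = (LINT s:{0..1}|lborel. (norm ((SOME g. cm_deriv h g) s))\<^sup>2)"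

definition cm_open :: "(real \<Rightarrow> real ^ 'd::finite) set \<Rightarrow> bool" where
  "cm_open U \<longleftrightarrow> U \<subseteq> cm_space \<and>
     (\<forall>h\<in>U. \<exists>r>0. \<forall>k\<in>cm_space. sqrt (cm_norm_sq (\<lambda>t. k t - h t)) < r \<longrightarrow> k \<in> U)"

definition cm_borel :: "(real \<Rightarrow> real ^ 'd::finite) measure" where
  "cm_borel = sigma cm_space {U. cm_open U}"

text \<open>
  Elements are representatives of the \<open>\<mu>\<close>-classes. Since the derivative of \<open>u w\<close> is only determined
  up to a null set of times depending on \<open>w\<close>, measurability of its values at fixed times has to
  be imposed on a jointly measurable version; every measurable \<open>u\<close> has one.
\<close>

definition L2_adapted ::
    "(real \<Rightarrow> real ^ 'd::finite) measure \<Rightarrow> ((real \<Rightarrow> real ^ 'd) \<Rightarrow> real \<Rightarrow> real ^ 'd) set" where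
  "L2_adapted \<mu> = {u. u \<in> measurable (completion \<mu>) cm_borel \<and>
     (\<integral>\<^sup>+w. ennreal (cm_norm_sq (u w)) \<partial>completion \<mu>) < \<infinity> \<and>
     (\<exists>v :: real \<Rightarrow> (real \<Rightarrow> real ^ 'd) \<Rightarrow> real ^ 'd.
        (\<lambda>(s, w). v s w) \<in> borel_measurable (restrict_space lborel {0..1} \<Otimes>\<^sub>M completion \<mu>) \<and>
        (\<forall>w\<in>space \<mu>. cm_deriv (u w) (\<lambda>s. v s w)) \<and>
        (AE s in lborel. s \<in> {0..1} \<longrightarrow> v s \<in> borel_measurable (completed_filtration \<mu> s)))}"

definition perturb ::
    "((real \<Rightarrow> real ^ 'd::finite) \<Rightarrow> real \<Rightarrow> real ^ 'd) \<Rightarrow> (real \<Rightarrow> real ^ 'd) \<Rightarrow> real \<Rightarrow> real ^ 'd" where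
  "perturb u w = (\<lambda>t\<in>{0..1}. w t + u w t)"

text \<open>
  Expectation with values in the extended reals. If the negative part is not integrable the value
  is set to \<open>-\<infinity>\<close>, so that a lower bound better than \<open>-\<infinity>\<close> entails that the expectation exists.
\<close>

definition ext_expectation :: "'a measure \<Rightarrow> ('a \<Rightarrow> real) \<Rightarrow> ereal" where
  "ext_expectation M X =
     (if (\<integral>\<^sup>+x. ennreal (- X x) \<partial>M) = \<infinity> then -\<infinity>
      else enn2ereal (\<integral>\<^sup>+x. ennreal (X x) \<partial>M) - enn2ereal (\<integral>\<^sup>+x. ennreal (- X x) \<partial>M))"

end

theory Submission
  imports Defs
begin

text \<open>
  Let \<open>T w = w + u w\<close>, let \<open>\<nu>\<close> be the law of \<open>T\<close> under \<open>\<mu>\<close> and let \<open>C = E[|u|\<^sup>2] / 2\<close>. The assertion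
  is equivalent to \<open>E[g \<circ> T] \<le> log E[exp g] + C\<close> for \<open>g = - f\<close>; by the duality between relative
  entropy and exponential moments this says that the entropy of \<open>\<nu>\<close> relative to \<open>\<mu>\<close> is at most
  the energy \<open>C\<close>. The proof uses neither stochastic integrals nor Girsanov's theorem: it establishes
  the inequality in discrete time and passes to the limit on the dual side, where only test
  functionals \<open>g\<close> occur.

  One Gaussian step. If \<open>\<gamma>\<close> is a centred Gaussian law with covariance \<open>v\<close> times the identity, the
  density of a translate together with Jensen's inequality gives
  \<open>\<integral> V (y + a) d\<gamma> \<le> log \<integral> exp V d\<gamma> + |a|\<^sup>2 / (2 v)\<close> (\<open>gaussian_shift_le_log_mgf\<close>).

  Finitely many steps. If the shift of every step is known before the step is drawn, the one-step
  bound can be iterated by dynamic programming, integrating out the last step first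
  (\<open>adapted_gaussian_shift_le\<close>). On the dyadic grid of mesh \<open>h = 2\<^sup>-\<^sup>m\<close> it is applied to the increments
  of Wiener measure. The increment of \<open>u\<close> over a cell is known only at the end of that cell, so
  \<open>u\<close> is delayed by one cell: the shifted path is \<open>w t + u w (t - h)\<close>. By the Cauchy--Schwarz
  inequality the total cost of the delayed shifts is at most \<open>C\<close>. Two facts make the shifts
  legitimate: increments of Wiener measure are independent of the completed past
  (\<open>completed_filtration_indep\<close>), and the time integral up to \<open>t\<close> of the derivative of \<open>u\<close> is almost
  surely equal to a variable that is measurable with respect to the past of \<open>t\<close>
  (\<open>integral_of_past_measurable\<close>).

  Limits. For a bounded \<open>g\<close> that depends continuously on the path at finitely many dyadic times,
  letting \<open>m\<close> tend to infinity removes the delay, because the paths of \<open>u\<close> are continuous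
  (\<open>cylinder_inequality\<close>). Such functionals are dense in \<open>L\<^sup>1(\<mu>)\<close> and \<open>L\<^sup>1(\<nu>)\<close> simultaneously
  (\<open>bounded_approximable\<close>), so the inequality holds for every bounded measurable \<open>g\<close>
  (\<open>bounded_inequality\<close>). Applied to large multiples of indicators of null sets it shows that \<open>\<nu>\<close> is
  absolutely continuous with respect to \<open>\<mu>\<close>, so that \<open>f \<circ> T\<close> does not depend on the version of \<open>f\<close>;
  applied to truncations of \<open>- f\<close> it gives first the integrability of the negative part of \<open>f \<circ> T\<close>
  and then the theorem.
\<close>

section \<open>Translates of a Gaussian vector\<close>

definition centred_gaussian :: "real \<Rightarrow> 'b::euclidean_space measure \<Rightarrow> bool" where
  "centred_gaussian v \<gamma> \<longleftrightarrow> v > 0 \<and> prob_space \<gamma> \<and>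
     (\<exists>c\<ge>0. \<gamma> = density lborel (\<lambda>y. ennreal (c * exp (- (norm y)\<^sup>2 / (2 * v)))))"

text \<open>
  Used for translations and for the reflection \<open>y \<mapsto> - y\<close>.
\<close>
lemma
  fixes F :: "'b::euclidean_space \<Rightarrow> real" and g :: "'b \<Rightarrow> 'b"
  assumes [measurable]: "F \<in> borel_measurable borel" "g \<in> borel_measurable borel"
    and g: "distr lborel borel g = lborel"
  shows integral_lborel_preserving: "(\<integral>y. F (g y) \<partial>lborel) = (\<integral>y. F y \<partial>lborel)"
    and integrable_lborel_preserving: "integrable lborel (\<lambda>y. F (g y)) \<longleftrightarrow> integrable lborel F"
proof -
  have "(\<integral>y. F y \<partial>lborel) = (\<integral>y. F y \<partial>distr lborel borel g)" by (simp add: g)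
  then show "(\<integral>y. F (g y) \<partial>lborel) = (\<integral>y. F y \<partial>lborel)" by (subst (asm) integral_distr) auto
  have "integrable lborel F = integrable (distr lborel borel g) F" by (simp add: g)
  then show "integrable lborel (\<lambda>y. F (g y)) = integrable lborel F"
    by (subst (asm) integrable_distr_eq) auto
qed

lemma lborel_distr_uminus_euclidean:
  "distr lborel borel (uminus :: 'b::euclidean_space \<Rightarrow> 'b) = lborel"
  using lborel_affine[of "-1" "0::'b"] by (simp add: density_1)

lemma abs_le_exp_plus_exp: "\<bar>x\<bar> \<le> exp x + exp (- x)" for x :: real
proof -
  have "\<bar>x\<bar> \<le> exp \<bar>x\<bar>" using exp_ge_add_one_self[of "\<bar>x\<bar>"] by linarith
  also have "\<dots> \<le> exp x + exp (- x)" by (auto simp: abs_if)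
  finally show ?thesis .
qed

text \<open>
  By \<open>p (y + a) = p y * exp (- (y \<bullet> a) / v - |a|\<^sup>2 / (2 v))\<close>, the substitution \<open>y \<mapsto> y + a\<close> turns
  \<open>\<integral> exp V d\<gamma>\<close> into \<open>\<integral> exp (V (y + a) - (y \<bullet> a) / v - |a|\<^sup>2 / (2 v)) \<gamma>(dy)\<close>. Jensen's inequality pulls the
  exponential out of the integral, and the term linear in \<open>y\<close> has mean zero. This is the Donsker--Varadhan
  inequality for the translate of \<open>\<gamma>\<close> by \<open>a\<close>, whose entropy relative to \<open>\<gamma>\<close> is \<open>|a|\<^sup>2 / (2 v)\<close>.
\<close>
lemma gaussian_shift_le_log_mgf:
  fixes V :: "'b::euclidean_space \<Rightarrow> real"
  assumes "centred_gaussian v \<gamma>" and [measurable]: "V \<in> borel_measurable borel"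
    and B: "\<And>y. \<bar>V y\<bar> \<le> B"
  shows "(\<integral>y. V (y + a) \<partial>\<gamma>) \<le> ln (\<integral>y. exp (V y) \<partial>\<gamma>) + (norm a)\<^sup>2 / (2 * v)"
proof -
  obtain c where v: "v > 0" and P: "prob_space \<gamma>" and c: "c \<ge> 0"
    and \<gamma>: "\<gamma> = density lborel (\<lambda>y. ennreal (c * exp (- (norm y)\<^sup>2 / (2 * v))))"
    using assms(1) unfolding centred_gaussian_def by auto
  interpret prob_space \<gamma> by fact
  define p where "p y = c * exp (- (norm y)\<^sup>2 / (2 * v))" for y :: 'b
  define e where "e a y = exp (- (y \<bullet> a) / v - (norm a)\<^sup>2 / (2 * v))" for a y :: 'b
  have p_nonneg: "p y \<ge> 0" for y using c by (simp add: p_def)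
  have [measurable]: "p \<in> borel_measurable borel" "e a \<in> borel_measurable borel" for a
    unfolding p_def e_def by measurable
  have sets_\<gamma>[simp, measurable_cong]: "sets \<gamma> = sets borel" by (simp add: \<gamma>)
  have space_\<gamma>[simp]: "space \<gamma> = UNIV" by (simp add: \<gamma>)
  have \<gamma>_int: "(\<integral>y. F y \<partial>\<gamma>) = (\<integral>y. p y * F y \<partial>lborel)"
    and \<gamma>_integrable: "integrable \<gamma> F \<longleftrightarrow> integrable lborel (\<lambda>y. p y * F y)"
    if "F \<in> borel_measurable borel" for F :: "'b \<Rightarrow> real"
    using that p_nonneg unfolding \<gamma> p_def[symmetric]
    by (auto simp: integral_density integrable_density)
  have p_shift: "p (y + a) = p y * e a y" for y a
  proof -
    have "(norm (y + a))\<^sup>2 = (norm y)\<^sup>2 + 2 * (y \<bullet> a) + (norm a)\<^sup>2"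
      by (simp add: power2_norm_eq_inner inner_add_left inner_add_right inner_commute)
    then have "- (norm (y + a))\<^sup>2 / (2 * v) = - (norm y)\<^sup>2 / (2 * v) + (- (y \<bullet> a) / v - (norm a)\<^sup>2 / (2 * v))"
      using v by (simp add: field_simps)
    then show ?thesis by (simp add: p_def e_def exp_add[symmetric] mult.assoc)
  qed
  have transl: "distr lborel borel (\<lambda>y. y + a) = lborel" for a :: 'b
    using lborel_distr_plus[of a] by (simp add: add.commute[of _ a])
  \<comment> \<open>Cameron--Martin formula for a single Gaussian vector\<close>
  have cm: "integrable \<gamma> (\<lambda>y. F (y + a) * e a y)"
    "(\<integral>y. F (y + a) * e a y \<partial>\<gamma>) = (\<integral>y. F y \<partial>\<gamma>)"
    if [measurable]: "F \<in> borel_measurable borel" and "integrable \<gamma> F" for F :: "'b \<Rightarrow> real" and a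
  proof -
    have "integrable lborel (\<lambda>y. p y * F y)" using \<gamma>_integrable that by auto
    then have "integrable lborel (\<lambda>y. p (y + a) * F (y + a))"
      by (subst integrable_lborel_preserving[where g = "\<lambda>y. y + a", OF _ _ transl]) auto
    then show "integrable \<gamma> (\<lambda>y. F (y + a) * e a y)"
      by (subst \<gamma>_integrable) (auto simp: p_shift ac_simps)
    have "(\<integral>y. p (y + a) * F (y + a) \<partial>lborel) = (\<integral>y. p y * F y \<partial>lborel)"
      by (subst integral_lborel_preserving[where g = "\<lambda>y. y + a", OF _ _ transl]) auto
    then show "(\<integral>y. F (y + a) * e a y \<partial>\<gamma>) = (\<integral>y. F y \<partial>\<gamma>)"
      by (subst (1 2) \<gamma>_int) (auto simp: p_shift ac_simps)
  qed
  have e_int: "integrable \<gamma> (e a)" for a using cm(1)[of "\<lambda>_. 1" a] by simp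
  \<comment> \<open>the exponentials of \<open>\<plusminus> (y \<bullet> a) / v\<close> are multiples of \<open>e (- a)\<close> and \<open>e a\<close>, hence integrable\<close>
  have lin_int: "integrable \<gamma> (\<lambda>y. y \<bullet> a)"
  proof (rule Bochner_Integration.integrable_bound)
    let ?K = "v * exp ((norm a)\<^sup>2 / (2 * v))"
    show "integrable \<gamma> (\<lambda>y. ?K * (e a y + e (- a) y))"
      using e_int by (intro integrable_mult_right Bochner_Integration.integrable_add)
    have "\<bar>y \<bullet> a\<bar> \<le> ?K * (e a y + e (- a) y)" for y
    proof -
      have "\<bar>y \<bullet> a\<bar> = v * \<bar>(y \<bullet> a) / v\<bar>" using v by simp
      also have "\<dots> \<le> v * (exp ((y \<bullet> a) / v) + exp (- ((y \<bullet> a) / v)))"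
        using v abs_le_exp_plus_exp[of "(y \<bullet> a) / v"] by (intro mult_left_mono) auto
      also have "\<dots> = ?K * (e a y + e (- a) y)"
        by (simp add: e_def exp_diff field_simps)
      finally show ?thesis .
    qed
    then show "AE y in \<gamma>. norm (y \<bullet> a) \<le> norm (?K * (e a y + e (- a) y))"
      by (intro AE_I2) (smt (verit) real_norm_def)
  qed auto
  have lin_zero: "(\<integral>y. y \<bullet> a \<partial>\<gamma>) = 0"
  proof -
    have "(\<integral>y. p (- y) * ((- y) \<bullet> a) \<partial>lborel) = (\<integral>y. p y * (y \<bullet> a) \<partial>lborel)"
      by (rule integral_lborel_preserving[where g = uminus, OF _ _ lborel_distr_uminus_euclidean]) auto
    moreover have "p (- y) * ((- y) \<bullet> a) = - (p y * (y \<bullet> a))" for y by (simp add: p_def)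
    ultimately have "- (\<integral>y. p y * (y \<bullet> a) \<partial>lborel) = (\<integral>y. p y * (y \<bullet> a) \<partial>lborel)"
      by (simp del: mult_minus_left mult_minus_right inner_minus_left)
    then show ?thesis by (subst \<gamma>_int) auto
  qed
  define q where "q y = V (y + a) + (- (y \<bullet> a) / v - (norm a)\<^sup>2 / (2 * v))" for y
  have V_int: "integrable \<gamma> (\<lambda>y. V (y + a))"
    by (rule integrable_const_bound[of _ B]) (use B in auto)
  have exp_q: "exp (q y) = exp (V (y + a)) * e a y" for y
    by (simp add: q_def e_def exp_add)
  have expV_int: "integrable \<gamma> (\<lambda>y. exp (V y))"
    by (rule integrable_const_bound[of _ "exp B"]) (use B in \<open>auto simp: abs_le_iff\<close>)
  have q_eq: "(\<integral>y. q y \<partial>\<gamma>) = (\<integral>y. V (y + a) \<partial>\<gamma>) - (norm a)\<^sup>2 / (2 * v)"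
    using V_int lin_int prob_space by (simp add: q_def lin_zero)
  have "exp (\<integral>y. q y \<partial>\<gamma>) \<le> (\<integral>y. exp (q y) \<partial>\<gamma>)"
  proof (rule jensens_inequality[where I = UNIV])
    show "integrable \<gamma> q" unfolding q_def using V_int lin_int by auto
    show "integrable \<gamma> (\<lambda>y. exp (q y))"
      unfolding exp_q by (rule cm) (auto intro: expV_int)
    show "convex_on UNIV exp" by (rule exp_convex)
  qed auto
  also have "(\<integral>y. exp (q y) \<partial>\<gamma>) = (\<integral>y. exp (V y) \<partial>\<gamma>)"
    unfolding exp_q by (rule cm) (auto intro: expV_int)
  finally have "exp (\<integral>y. q y \<partial>\<gamma>) \<le> (\<integral>y. exp (V y) \<partial>\<gamma>)" .
  then have "(\<integral>y. q y \<partial>\<gamma>) \<le> ln (\<integral>y. exp (V y) \<partial>\<gamma>)"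
    by (subst ln_ge_iff) (auto intro: order.strict_trans2[OF exp_gt_zero])
  then show ?thesis unfolding q_eq by simp
qed

lemma (in prob_space)
  fixes V :: "'a \<Rightarrow> real"
  assumes [measurable]: "V \<in> borel_measurable M" and B: "\<And>y. \<bar>V y\<bar> \<le> B"
  shows expectation_exp_ge: "exp (- B) \<le> expectation (\<lambda>x. exp (V x))"
    and log_mgf_bounded: "\<bar>ln (expectation (\<lambda>x. exp (V x)))\<bar> \<le> B"
proof -
  have i: "integrable M (\<lambda>y. exp (V y))"
    by (rule integrable_const_bound[of _ "exp B"]) (use B in \<open>auto simp: abs_le_iff\<close>)
  have b: "- B \<le> V y" "V y \<le> B" for y using B[of y] by auto
  show 1: "exp (- B) \<le> expectation (\<lambda>x. exp (V x))"
    by (rule integral_ge_const[OF i]) (use b in auto)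
  have 2: "expectation (\<lambda>x. exp (V x)) \<le> exp B"
    by (rule integral_le_const[OF i]) (use b in auto)
  have "0 < expectation (\<lambda>x. exp (V x))" using 1 exp_gt_zero by (rule order.strict_trans2[rotated])
  then show "\<bar>ln (expectation (\<lambda>x. exp (V x)))\<bar> \<le> B"
    using 1 2 by (metis abs_le_iff exp_le_cancel_iff exp_ln minus_le_iff)
qed

lemma (in prob_space) indep_pair_integral:
  fixes F :: "'b \<times> 'c \<Rightarrow> real" and X :: "'a \<Rightarrow> 'b" and Y :: "'a \<Rightarrow> 'c"
  assumes X[measurable]: "X \<in> measurable M N" and Y[measurable]: "Y \<in> measurable M L"
    and ind: "distr M (N \<Otimes>\<^sub>M L) (\<lambda>w. (X w, Y w)) = distr M N X \<Otimes>\<^sub>M distr M L Y"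
    and F[measurable]: "F \<in> borel_measurable (N \<Otimes>\<^sub>M L)" and B: "\<And>z. \<bar>F z\<bar> \<le> B"
  shows "expectation (\<lambda>w. F (X w, Y w)) = expectation (\<lambda>w. \<integral>y. F (X w, y) \<partial>distr M L Y)"
proof -
  interpret L: prob_space "distr M L Y" by (rule prob_space_distr) fact
  interpret N: prob_space "distr M N X" by (rule prob_space_distr) fact
  interpret NL: pair_prob_space "distr M N X" "distr M L Y" ..
  have "expectation (\<lambda>w. F (X w, Y w)) = (\<integral>z. F z \<partial>distr M (N \<Otimes>\<^sub>M L) (\<lambda>w. (X w, Y w)))"
    by (subst integral_distr) auto
  also have "\<dots> = (\<integral>z. F z \<partial>(distr M N X \<Otimes>\<^sub>M distr M L Y))"
    by (simp add: ind)
  also have "\<dots> = (\<integral>x. \<integral>y. F (x, y) \<partial>distr M L Y \<partial>distr M N X)"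
    by (rule NL.integral_fst'[symmetric], rule NL.P.integrable_const_bound[of _ B]) (use B in auto)
  also have "\<dots> = expectation (\<lambda>w. \<integral>y. F (X w, y) \<partial>distr M L Y)"
    by (subst integral_distr) auto
  finally show ?thesis .
qed

section \<open>Adapted translations of independent Gaussian steps\<close>

text \<open>
  Conditionally on \<open>(X, a)\<close> the vector \<open>\<xi>\<close> still has its Gaussian law, so the bound for a deterministic
  translation applies to \<open>G (X, _)\<close> for each value of \<open>(X, a)\<close> and can be averaged.
\<close>
lemma (in prob_space) independent_gaussian_shift_le:
  fixes \<xi> a :: "'a \<Rightarrow> 'b::euclidean_space" and G :: "'c \<times> 'b \<Rightarrow> real"
  assumes X[measurable]: "X \<in> measurable M N" and a[measurable]: "a \<in> borel_measurable M"
    and \<xi>[measurable]: "\<xi> \<in> borel_measurable M"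
    and ind: "distr M ((N \<Otimes>\<^sub>M borel) \<Otimes>\<^sub>M borel) (\<lambda>w. ((X w, a w), \<xi> w))
      = distr M (N \<Otimes>\<^sub>M borel) (\<lambda>w. (X w, a w)) \<Otimes>\<^sub>M distr M borel \<xi>"
    and gauss: "centred_gaussian v (distr M borel \<xi>)"
    and G[measurable]: "G \<in> borel_measurable (N \<Otimes>\<^sub>M borel)" and B: "\<And>z. \<bar>G z\<bar> \<le> B"
    and a2: "integrable M (\<lambda>w. (norm (a w))\<^sup>2)"
  shows "expectation (\<lambda>w. G (X w, \<xi> w + a w))
    \<le> expectation (\<lambda>w. ln (\<integral>y. exp (G (X w, y)) \<partial>distr M borel \<xi>))
       + expectation (\<lambda>w. (norm (a w))\<^sup>2) / (2 * v)"
proof -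
  interpret L: prob_space "distr M borel \<xi>" by (rule prob_space_distr) fact
  have log_int: "integrable M (\<lambda>w. ln (\<integral>y. exp (G (X w, y)) \<partial>distr M borel \<xi>))"
  proof -
    have "\<bar>ln (\<integral>y. exp (G (X w, y)) \<partial>distr M borel \<xi>)\<bar> \<le> B" if "w \<in> space M" for w
    proof (rule L.log_mgf_bounded)
      have "X w \<in> space N" using that X by (rule measurable_space[rotated])
      then show "(\<lambda>y. G (X w, y)) \<in> borel_measurable (distr M borel \<xi>)" by simp
    qed (rule B)
    then show "integrable M (\<lambda>w. ln (\<integral>y. exp (G (X w, y)) \<partial>distr M borel \<xi>))"
      by (intro integrable_const_bound[of _ B]) auto
  qed
  have "expectation (\<lambda>w. G (X w, \<xi> w + a w))
      = expectation (\<lambda>w. (\<lambda>z. G (fst (fst z), snd z + snd (fst z))) ((X w, a w), \<xi> w))" by simp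
  also have "\<dots> = expectation (\<lambda>w. \<integral>y. (\<lambda>z. G (fst (fst z), snd z + snd (fst z))) ((X w, a w), y) \<partial>distr M borel \<xi>)"
    by (rule indep_pair_integral[OF _ _ ind, of _ B]) (use B in auto)
  also have "\<dots> \<le> expectation (\<lambda>w. ln (\<integral>y. exp (G (X w, y)) \<partial>distr M borel \<xi>)
       + (norm (a w))\<^sup>2 / (2 * v))"
  proof (rule integral_mono)
    have "\<bar>\<integral>y. G (X w, y + a w) \<partial>distr M borel \<xi>\<bar> \<le> B" if "w \<in> space M" for w
    proof -
      have "X w \<in> space N" using that X by (rule measurable_space[rotated])
      then have "integrable (distr M borel \<xi>) (\<lambda>y. G (X w, y + a w))"
        by (intro L.integrable_const_bound[of _ B]) (use B in auto)
      then show ?thesis using B unfolding abs_le_iff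
        by (auto intro!: L.integral_le_const L.integral_ge_const simp: abs_le_iff minus_le_iff)
    qed
    then show "integrable M (\<lambda>w. \<integral>y. (\<lambda>z. G (fst (fst z), snd z + snd (fst z))) ((X w, a w), y) \<partial>distr M borel \<xi>)"
      by (intro integrable_const_bound[of _ B]) auto
    show "integrable M (\<lambda>w. ln (\<integral>y. exp (G (X w, y)) \<partial>distr M borel \<xi>) + (norm (a w))\<^sup>2 / (2 * v))"
      using log_int a2 by auto
  next
    fix w assume "w \<in> space M"
    then have "X w \<in> space N" using X by (rule measurable_space[rotated])
    then have [measurable]: "(\<lambda>y. G (X w, y)) \<in> borel_measurable borel" by simp
    show "(\<integral>y. (\<lambda>z. G (fst (fst z), snd z + snd (fst z))) ((X w, a w), y) \<partial>distr M borel \<xi>)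
        \<le> ln (\<integral>y. exp (G (X w, y)) \<partial>distr M borel \<xi>) + (norm (a w))\<^sup>2 / (2 * v)"
      using gaussian_shift_le_log_mgf[OF gauss, of "\<lambda>y. G (X w, y)" B "a w"] B by simp
  qed
  also have "\<dots> = expectation (\<lambda>w. ln (\<integral>y. exp (G (X w, y)) \<partial>distr M borel \<xi>))
       + expectation (\<lambda>w. (norm (a w))\<^sup>2) / (2 * v)"
    using log_int a2 by simp
  finally show ?thesis .
qed

text \<open>
  Stated with events, because the past enters as a sigma-algebra and not through a random variable.
\<close>
definition indep_of_past :: "'a measure \<Rightarrow> 'a measure \<Rightarrow> ('a \<Rightarrow> 'b::topological_space) \<Rightarrow> bool" where
  "indep_of_past M F \<xi> \<longleftrightarrow> (\<forall>A\<in>sets F. \<forall>B\<in>sets borel.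
     measure M (A \<inter> (\<xi> -` B \<inter> space M)) = measure M A * measure M (\<xi> -` B \<inter> space M))"

lemma (in prob_space) indep_of_past_imp_distr_pair:
  fixes \<xi> :: "'a \<Rightarrow> 'b::topological_space"
  assumes F: "subalgebra M F" and X: "X \<in> measurable F N" and \<xi>[measurable]: "\<xi> \<in> borel_measurable M"
    and ind: "indep_of_past M F \<xi>"
  shows "distr M (N \<Otimes>\<^sub>M borel) (\<lambda>w. (X w, \<xi> w)) = distr M N X \<Otimes>\<^sub>M distr M borel \<xi>"
proof (rule pair_measure_eqI[symmetric])
  have X'[measurable]: "X \<in> measurable M N" by (rule measurable_from_subalg[OF F X])
  show "sigma_finite_measure (distr M N X)" "sigma_finite_measure (distr M borel \<xi>)"
    by (intro prob_space_imp_sigma_finite prob_space_distr; simp)+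
  fix A B assume A: "A \<in> sets (distr M N X)" and B: "B \<in> sets (distr M borel \<xi>)"
  have eq: "(\<lambda>w. (X w, \<xi> w)) -` (A \<times> B) \<inter> space M = (X -` A \<inter> space M) \<inter> (\<xi> -` B \<inter> space M)" by auto
  have "X -` A \<inter> space M \<in> sets F" using A X F by (auto simp: subalgebra_def dest: measurable_sets)
  then have "prob ((X -` A \<inter> space M) \<inter> (\<xi> -` B \<inter> space M)) = prob (X -` A \<inter> space M) * prob (\<xi> -` B \<inter> space M)"
    using ind B by (auto simp: indep_of_past_def)
  then show "emeasure (distr M N X) A * emeasure (distr M borel \<xi>) B
      = emeasure (distr M (N \<Otimes>\<^sub>M borel) (\<lambda>w. (X w, \<xi> w))) (A \<times> B)"
    using A B by (simp add: emeasure_distr eq emeasure_eq_measure ennreal_mult)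
qed simp

text \<open>
  Dynamic programming. Integrating the last step out of \<open>exp G\<close> and taking the logarithm gives a functional
  \<open>L\<close> of the earlier steps. The one-step bound, with all earlier shifted steps in the role of \<open>X\<close>,
  replaces \<open>G\<close> by \<open>L\<close> at the cost of the last shift, whereas on the unshifted side this replacement is an
  identity: \<open>E[exp L] = E[exp G]\<close>.
\<close>
proposition (in prob_space) adapted_gaussian_shift_le:
  fixes \<xi> a :: "nat \<Rightarrow> 'a \<Rightarrow> 'b::euclidean_space" and G :: "(nat \<Rightarrow> 'b) \<Rightarrow> real"
  assumes F: "\<And>k. subalgebra M (F k)" and mono: "\<And>j k. j \<le> k \<Longrightarrow> k < n \<Longrightarrow> sets (F j) \<subseteq> sets (F k)"
    and a: "\<And>k. k < n \<Longrightarrow> a k \<in> borel_measurable (F k)"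
    and \<xi>: "\<And>k. k < n \<Longrightarrow> \<xi> k \<in> borel_measurable M"
    and \<xi>F: "\<And>j k. j < k \<Longrightarrow> k < n \<Longrightarrow> \<xi> j \<in> borel_measurable (F k)"
    and ind: "\<And>k. k < n \<Longrightarrow> indep_of_past M (F k) (\<xi> k)"
    and gauss: "\<And>k. k < n \<Longrightarrow> centred_gaussian v (distr M borel (\<xi> k))"
    and a2: "\<And>k. k < n \<Longrightarrow> integrable M (\<lambda>w. (norm (a k w))\<^sup>2)"
    and G: "G \<in> borel_measurable (Pi\<^sub>M {..<n} (\<lambda>_. borel))" and B: "\<And>z. \<bar>G z\<bar> \<le> B"
  shows "expectation (\<lambda>w. G (\<lambda>i\<in>{..<n}. \<xi> i w + a i w))
    \<le> ln (expectation (\<lambda>w. exp (G (\<lambda>i\<in>{..<n}. \<xi> i w))))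
       + (\<Sum>k<n. expectation (\<lambda>w. (norm (a k w))\<^sup>2) / (2 * v))"
proof -
  have "k \<le> n \<Longrightarrow> G \<in> borel_measurable (Pi\<^sub>M {..<k} (\<lambda>_. borel)) \<Longrightarrow> (\<And>z. \<bar>G z\<bar> \<le> B) \<Longrightarrow>
    expectation (\<lambda>w. G (\<lambda>i\<in>{..<k}. \<xi> i w + a i w))
    \<le> ln (expectation (\<lambda>w. exp (G (\<lambda>i\<in>{..<k}. \<xi> i w))))
       + (\<Sum>i<k. expectation (\<lambda>w. (norm (a i w))\<^sup>2) / (2 * v))" for k and G :: "(nat \<Rightarrow> 'b) \<Rightarrow> real"
  proof (induction k arbitrary: G)
    case 0
    then show ?case by (simp add: prob_space)
  next
    case (Suc k)
    then have k: "k < n" by simp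
    note [measurable] = Suc.prems(2)
    let ?P = "Pi\<^sub>M {..<k} (\<lambda>_. borel :: 'b measure)"
    let ?\<gamma> = "distr M borel (\<xi> k)"
    define X where "X w = (\<lambda>i\<in>{..<k}. \<xi> i w + a i w)" for w
    define X0 where "X0 w = (\<lambda>i\<in>{..<k}. \<xi> i w)" for w
    define G' where "G' = (\<lambda>(x, y). G (x(k := y)))"
    define L where "L x = ln (\<integral>y. exp (G' (x, y)) \<partial>?\<gamma>)" for x
    interpret \<gamma>: prob_space ?\<gamma> using \<xi>[OF k] by (rule prob_space_distr)
    have G'[measurable]: "G' \<in> borel_measurable (?P \<Otimes>\<^sub>M borel)"
      unfolding G'_def using measurable_compose[OF measurable_add_dim[of k "{..<k}" "\<lambda>_. borel"] Suc.prems(2)[unfolded lessThan_Suc]]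
      by (simp add: case_prod_beta' fun_upd_def)
    have L_meas[measurable]: "L \<in> borel_measurable ?P" unfolding L_def by measurable
    have G'_B: "\<bar>G' z\<bar> \<le> B" for z using Suc.prems(3) by (auto simp: G'_def split: prod.split)
    have aF: "a i \<in> borel_measurable (F k)" if "i \<le> k" for i
      using a[of i] mono[of i k] that k F[of i] F[of k]
      by (auto simp: subalgebra_def intro: measurable_mono1 simp flip: subset_iff
           dest: measurable_mono[of "borel" "borel" "F i" "F k", THEN subsetD, rotated -1])
    have X: "X \<in> measurable (F k) ?P" unfolding X_def
      using aF \<xi>F k by (intro measurable_restrict borel_measurable_add) auto
    have X0: "X0 \<in> measurable (F k) ?P" unfolding X0_def
      using \<xi>F k by (intro measurable_restrict) auto
    have [measurable]: "X \<in> measurable M ?P" "X0 \<in> measurable M ?P" "a k \<in> borel_measurable M" "\<xi> k \<in> borel_measurable M"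
      using X X0 aF[of k] measurable_from_subalg[OF F] \<xi> k by auto
    have XS: "(\<lambda>i\<in>{..<Suc k}. \<xi> i w + a i w) = (X w)(k := \<xi> k w + a k w)"
      and X0S: "(\<lambda>i\<in>{..<Suc k}. \<xi> i w) = (X0 w)(k := \<xi> k w)" for w
      by (auto simp: X_def X0_def fun_eq_iff restrict_def)
    have L_B: "\<bar>L x\<bar> \<le> B" if "x \<in> space ?P" for x unfolding L_def
      by (rule \<gamma>.log_mgf_bounded) (use that G'_B in auto)
    have "expectation (\<lambda>w. G (\<lambda>i\<in>{..<Suc k}. \<xi> i w + a i w)) = expectation (\<lambda>w. G' (X w, \<xi> k w + a k w))"
      by (simp only: XS G'_def split)
    also have "\<dots> \<le> expectation (\<lambda>w. L (X w)) + expectation (\<lambda>w. (norm (a k w))\<^sup>2) / (2 * v)"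
      unfolding L_def
      by (rule independent_gaussian_shift_le[where N = ?P and B = B])
         (use X aF k gauss a2 G'_B in \<open>auto intro!: indep_of_past_imp_distr_pair[OF F _ _ ind]\<close>)
    \<comment> \<open>\<open>L\<close> is bounded by \<open>B\<close> on the product space only, the induction hypothesis wants a bound everywhere\<close>
    also have "expectation (\<lambda>w. L (X w)) = expectation (\<lambda>w. (\<lambda>x. max (- B) (min B (L x))) (X w))"
    proof (rule Bochner_Integration.integral_cong)
      fix w assume "w \<in> space M"
      then have "X w \<in> space ?P" by (rule measurable_space[rotated]) simp
      then show "L (X w) = max (- B) (min B (L (X w)))" using L_B[of "X w"] by auto
    qed simp
    also have "\<dots> \<le> ln (expectation (\<lambda>w. exp (max (- B) (min B (L (X0 w))))))
       + (\<Sum>i<k. expectation (\<lambda>w. (norm (a i w))\<^sup>2) / (2 * v))"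
    proof -
      have "B \<ge> 0" using Suc.prems(3)[of undefined] by simp
      then show ?thesis unfolding X_def X0_def using k by (intro Suc.IH) auto
    qed
    also have "expectation (\<lambda>w. exp (max (- B) (min B (L (X0 w))))) = expectation (\<lambda>w. \<integral>y. exp (G' (X0 w, y)) \<partial>?\<gamma>)"
    proof (rule Bochner_Integration.integral_cong)
      fix w assume "w \<in> space M"
      then have w: "X0 w \<in> space ?P" by (rule measurable_space[rotated]) simp
      have "exp (max (- B) (min B (L (X0 w)))) = exp (L (X0 w))" using L_B[OF w] by (auto simp: abs_le_iff)
      also have "\<dots> = (\<integral>y. exp (G' (X0 w, y)) \<partial>?\<gamma>)"
      proof -
        have "exp (- B) \<le> (\<integral>y. exp (G' (X0 w, y)) \<partial>?\<gamma>)"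
          by (rule \<gamma>.expectation_exp_ge) (use w G'_B in auto)
        then have "0 < (\<integral>y. exp (G' (X0 w, y)) \<partial>?\<gamma>)" using exp_gt_zero by (rule order.strict_trans2[rotated])
        then show ?thesis unfolding L_def by simp
      qed
      finally show "exp (max (- B) (min B (L (X0 w)))) = (\<integral>y. exp (G' (X0 w, y)) \<partial>?\<gamma>)" .
    qed simp
    also have "\<dots> = expectation (\<lambda>w. exp (G' (X0 w, \<xi> k w)))"
      by (rule indep_pair_integral[symmetric, where N = ?P and B = "exp B" and F = "\<lambda>z. exp (G' z)"])
        (use X0 k G'_B in \<open>auto intro!: indep_of_past_imp_distr_pair[OF F _ _ ind] simp: abs_le_iff\<close>)
    also have "\<dots> = expectation (\<lambda>w. exp (G (\<lambda>i\<in>{..<Suc k}. \<xi> i w)))"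
      by (simp only: X0S G'_def split)
    finally show ?case by (simp only: sum.lessThan_Suc) (simp only: ac_simps)
  qed
  from this[OF order_refl G B] show ?thesis .
qed

section \<open>Independence of Wiener increments from the completed past\<close>

lemma prod_normal_density_eq:
  fixes x :: "real ^ 'd::finite"
  assumes "\<sigma> > 0"
  shows "(\<Prod>i\<in>UNIV. normal_density 0 \<sigma> (x $ i))
    = (1 / sqrt (2 * pi * \<sigma>\<^sup>2)) ^ CARD('d) * exp (- (norm x)\<^sup>2 / (2 * \<sigma>\<^sup>2))"
proof -
  have "(norm x)\<^sup>2 = (\<Sum>i\<in>UNIV. (x $ i)\<^sup>2)"
    unfolding power2_norm_eq_inner inner_vec_def by (simp add: power2_eq_square)
  then have "exp (- (norm x)\<^sup>2 / (2 * \<sigma>\<^sup>2)) = (\<Prod>i\<in>UNIV. exp (- (x $ i)\<^sup>2 / (2 * \<sigma>\<^sup>2)))"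
    by (simp add: exp_sum[symmetric] sum_negf sum_divide_distrib[symmetric] flip: minus_divide_left)
  then show ?thesis unfolding normal_density_def by (simp add: prod.distrib prod_dividef power_divide)
qed

lemma dyadic_floor_tendsto:
  fixes w :: "real \<Rightarrow> 'b::topological_space"
  assumes w: "continuous_on {0..1} w" and s: "s \<in> {0..1}"
  shows "(\<lambda>m. w (real (nat \<lfloor>s * 2 ^ m\<rfloor>) / 2 ^ m)) \<longlonglongrightarrow> w s"
proof (rule continuous_on_tendsto_compose[OF w _ s])
  have le: "real (nat \<lfloor>s * 2 ^ m\<rfloor>) / 2 ^ m \<le> s" for m :: nat
    using s by (simp add: field_simps)
  have ge: "s - (1 / 2) ^ m \<le> real (nat \<lfloor>s * 2 ^ m\<rfloor>) / 2 ^ m" for m :: nat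
  proof -
    have "real (nat \<lfloor>s * 2 ^ m\<rfloor>) \<ge> s * 2 ^ m - 1" using s by (simp add: of_nat_nat)
    then have "(s * 2 ^ m - 1) / 2 ^ m \<le> real (nat \<lfloor>s * 2 ^ m\<rfloor>) / 2 ^ m" by (rule divide_right_mono) simp
    then show ?thesis by (simp add: diff_divide_distrib power_one_over)
  qed
  show "(\<lambda>m. real (nat \<lfloor>s * 2 ^ m\<rfloor>) / 2 ^ m) \<longlonglongrightarrow> s"
  proof (rule tendsto_sandwich)
    show "(\<lambda>m. s - (1 / 2) ^ m) \<longlonglongrightarrow> s"
      using tendsto_diff[OF tendsto_const[of s] LIMSEQ_power_zero[of "1/2::real"]] by simp
    show "(\<lambda>m. s) \<longlonglongrightarrow> s" by simp
  qed (use le ge in auto)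
  show "\<forall>\<^sub>F m in sequentially. real (nat \<lfloor>s * 2 ^ m\<rfloor>) / 2 ^ m \<in> {0..1}"
    using order_trans[OF le, of 1] s unfolding atLeastAtMost_iff
    by (intro always_eventually allI conjI) simp_all
qed

text \<open>
  The past without null sets, and the past seen at times of the dyadic grid of level \<open>m\<close>. The latter
  increases with \<open>m\<close>, and by continuity of paths all levels together generate the former.
\<close>
definition past_events :: "(real \<Rightarrow> real ^ 'd::finite) measure \<Rightarrow> real \<Rightarrow> (real \<Rightarrow> real ^ 'd) set set" where
  "past_events \<mu> t = sigma_sets (space \<mu>) {{w \<in> space \<mu>. w s \<in> A} | s A. s \<in> {0..t} \<and> A \<in> sets borel}"

definition dyadic_past_events :: "(real \<Rightarrow> real ^ 'd::finite) measure \<Rightarrow> nat \<Rightarrow> real \<Rightarrow> (real \<Rightarrow> real ^ 'd) set set" where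
  "dyadic_past_events \<mu> m t = sigma_sets (space \<mu>)
     {{w \<in> space \<mu>. w (real j / 2 ^ m) \<in> A} | j A. real j / 2 ^ m \<le> t \<and> A \<in> sets borel}"

lemma dyadic_past_events_mono:
  assumes "m \<le> m'" shows "dyadic_past_events \<mu> m t \<subseteq> dyadic_past_events \<mu> m' t"
  unfolding dyadic_past_events_def
proof (rule sigma_sets_mono', safe)
  fix j and A :: "(real ^ 'a) set" assume j: "real j / 2 ^ m \<le> t" and A: "A \<in> sets borel"
  have "real j / 2 ^ m = real (j * 2 ^ (m' - m)) / 2 ^ m'"
    using assms by (simp add: field_simps flip: power_add)
  then show "\<exists>j' A'. {w \<in> space \<mu>. w (real j / 2 ^ m) \<in> A} = {w \<in> space \<mu>. w (real j' / 2 ^ m') \<in> A'}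
      \<and> real j' / 2 ^ m' \<le> t \<and> A' \<in> sets borel"
    using j A by (intro exI[of _ "j * 2 ^ (m' - m)"] exI[of _ A]) simp
qed

context wiener_measure
begin

lemma space_wiener: "space \<mu> = {w \<in> extensional {0..1}. continuous_on {0..1} w \<and> w 0 = 0}"
proof -
  have "space \<mu> = space path_space" by (rule sets_eq_imp_space_eq[OF sets_eq])
  then show ?thesis by (auto simp: path_space_def space_restrict_space space_PiM PiE_def)
qed

lemma coordinate_measurable: "t \<in> {0..1} \<Longrightarrow> (\<lambda>w. w t) \<in> borel_measurable \<mu>"
  using measurable_restrict_space1[OF measurable_component_singleton[of t "{0..1}" "\<lambda>_. borel"]]
  by (subst measurable_cong_sets[OF sets_eq refl]) (auto simp: path_space_def)

text \<open>
  The sigma-algebra of Wiener space is generated by the coordinates.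
\<close>
lemma measurable_into_wiener:
  assumes "\<And>x. x \<in> space N \<Longrightarrow> T x \<in> space \<mu>"
    and "\<And>t. t \<in> {0..1} \<Longrightarrow> (\<lambda>x. T x t) \<in> borel_measurable N"
  shows "T \<in> measurable N \<mu>"
proof -
  have "T \<in> measurable N (restrict_space (\<Pi>\<^sub>M t\<in>{0..1}. borel) {w. continuous_on {0..1} w \<and> w 0 = 0})"
  proof (rule measurable_restrict_space2)
    show "T \<in> space N \<rightarrow> {w. continuous_on {0..1} w \<and> w 0 = 0}"
      using assms(1) unfolding space_wiener by auto
    show "T \<in> measurable N (\<Pi>\<^sub>M t\<in>{0..1}. borel)"
      by (rule measurable_PiM_single') (use assms in \<open>auto simp: space_wiener PiE_def\<close>)
  qed
  then show ?thesis by (subst measurable_cong_sets[OF refl sets_eq]) (simp add: path_space_def)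
qed

lemma increment_gaussian:
  assumes "0 \<le> s" "s < t" "t \<le> 1"
  shows "centred_gaussian (t - s) (distr \<mu> borel (\<lambda>w. w t - w s))"
proof -
  have [measurable]: "(\<lambda>w. w t - w s) \<in> borel_measurable \<mu>"
    using assms coordinate_measurable[of t] coordinate_measurable[of s] by simp
  let ?c = "(1 / sqrt (2 * pi * (t - s))) ^ CARD('d)"
  have "distr \<mu> borel (\<lambda>w. w t - w s) = distr \<mu> lborel (\<lambda>w. w t - w s)"
    by (rule distr_cong) auto
  also have "\<dots> = density lborel (\<lambda>x. ennreal (\<Prod>i\<in>UNIV. normal_density 0 (sqrt (t - s)) (x $ i)))"
    using gaussian_increments[OF assms] by (simp add: distributed_def)
  also have "\<dots> = density lborel (\<lambda>x. ennreal (?c * exp (- (norm x)\<^sup>2 / (2 * (t - s)))))"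
    using assms by (simp add: prod_normal_density_eq)
  finally show ?thesis
    unfolding centred_gaussian_def using assms prob_space_distr[of "\<lambda>w. w t - w s" borel]
    by (intro conjI exI[of _ ?c]) auto
qed

text \<open>
  The positions on the grid up to time \<open>k / 2^n\<close> are sums of the increments over the cells before that
  time. Together with the increment up to \<open>t'\<close> these form consecutive increments along one time sequence, and
  hence an independent family.
\<close>
lemma dyadic_past_indep:
  assumes n: "n \<le> m" and t': "real k / 2 ^ n \<le> t'" "t' \<le> 1"
    and A: "A \<in> dyadic_past_events \<mu> m (real k / 2 ^ n)" and B: "B \<in> sets borel"
  shows "A \<in> sets \<mu>"
    and "prob (A \<inter> ((\<lambda>w. w t' - w (real k / 2 ^ n)) -` B \<inter> space \<mu>))
      = prob A * prob ((\<lambda>w. w t' - w (real k / 2 ^ n)) -` B \<inter> space \<mu>)"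
proof -
  define K where "K = k * 2 ^ (m - n)"
  have K: "real k / 2 ^ n = real K / 2 ^ m"
    using n by (simp add: K_def field_simps flip: power_add)
  define \<tau> where "\<tau> i = (if i \<le> K then real i / 2 ^ m else t')" for i
  have iK: "i \<le> K \<Longrightarrow> real i / 2 ^ m \<le> t'" for i
    using t' K by (auto intro: order_trans[rotated] simp: divide_right_mono)
  have \<tau>_mono: "mono \<tau>" using iK by (auto simp: mono_def \<tau>_def divide_right_mono)
  have "\<tau> i \<le> t'" "0 \<le> \<tau> i" for i
    using iK order_trans[OF _ t'(1), of 0] by (auto simp: \<tau>_def)
  then have \<tau>_range: "range \<tau> \<subseteq> {0..1}" using order_trans[OF _ t'(2)] by (auto simp: image_subset_iff)
  let ?D = "\<lambda>i w. w (\<tau> (Suc i)) - w (\<tau> i)"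
  let ?N = "Pi\<^sub>M {..<K} (\<lambda>_. borel :: (real ^ 'd) measure)"
  let ?L = "Pi\<^sub>M {K} (\<lambda>_. borel :: (real ^ 'd) measure)"
  let ?X = "\<lambda>w. restrict (\<lambda>i. ?D i w) {..<K}" and ?Y = "\<lambda>w. restrict (\<lambda>i. ?D i w) {K}"
  have ind: "indep_var ?N ?X ?L ?Y"
    using indep_increments[OF \<tau>_mono \<tau>_range, of "Suc K"] by (rule indep_var_restrict) auto
  then have X: "?X \<in> measurable \<mu> ?N" unfolding indep_var_eq by blast
  have sum_X: "(\<Sum>i<j. ?X w i) = w (real j / 2 ^ m)" if "j \<le> K" "w \<in> space \<mu>" for j w
  proof -
    have "(\<Sum>i<j. ?X w i) = (\<Sum>i<j. ?D i w)" using that by (intro sum.cong) auto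
    also have "\<dots> = w (\<tau> j) - w (\<tau> 0)" by (induction j) auto
    finally show ?thesis using that by (simp add: \<tau>_def space_wiener)
  qed
  have "dyadic_past_events \<mu> m (real k / 2 ^ n) \<subseteq> sets (vimage_algebra (space \<mu>) ?X ?N)"
    unfolding dyadic_past_events_def
  proof (rule sets.sigma_sets_subset[of _ "vimage_algebra (space \<mu>) ?X ?N", simplified], safe)
    fix j and A :: "(real ^ 'd) set" assume j: "real j / 2 ^ m \<le> real k / 2 ^ n" and A: "A \<in> sets borel"
    have "j \<le> K" using j unfolding K by (simp add: divide_le_cancel)
    then have "{w \<in> space \<mu>. w (real j / 2 ^ m) \<in> A} = ?X -` {x \<in> space ?N. (\<Sum>i<j. x i) \<in> A} \<inter> space \<mu>"
      using sum_X[of j] measurable_space[OF X] by auto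
    moreover have "{x \<in> space ?N. (\<Sum>i<j. x i) \<in> A} \<in> sets ?N"
      using A \<open>j \<le> K\<close> by (intro measurable_sets_Collect[of _ ?N borel] borel_measurable_sum measurable_component_singleton) auto
    ultimately show "{w \<in> space \<mu>. w (real j / 2 ^ m) \<in> A} \<in> sets (vimage_algebra (space \<mu>) ?X ?N)"
      by (metis (no_types, lifting) in_vimage_algebra)
  qed
  then obtain E where E: "E \<in> sets ?N" "A = ?X -` E \<inter> space \<mu>"
    using A measurable_space[OF X] by (auto simp: sets_vimage_algebra2 Pi_def)
  then show "A \<in> sets \<mu>" using X by (auto dest: measurable_sets)
  define B' where "B' = {x \<in> space ?L. x K \<in> B}"
  have B': "B' \<in> sets ?L" unfolding B'_def
    using B by (intro measurable_sets_Collect[of _ ?L borel] measurable_component_singleton) auto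
  have B'_eq: "?Y -` B' \<inter> space \<mu> = (\<lambda>w. w t' - w (real k / 2 ^ n)) -` B \<inter> space \<mu>"
    by (auto simp: B'_def \<tau>_def K space_PiM)
  show "prob (A \<inter> ((\<lambda>w. w t' - w (real k / 2 ^ n)) -` B \<inter> space \<mu>))
      = prob A * prob ((\<lambda>w. w t' - w (real k / 2 ^ n)) -` B \<inter> space \<mu>)"
    using indep_varD[OF ind E(1) B'] unfolding B'_eq[symmetric] E(2)
    by (simp add: vimage_Int[symmetric] Int_ac Times_eq_cancel2 vimage_def Int_def conj_ac)
qed

lemma past_events_subset_dyadic:
  assumes "t \<le> 1"
  shows "past_events \<mu> t \<subseteq> sigma_sets (space \<mu>) (\<Union>m\<in>{n..}. dyadic_past_events \<mu> m t)"
proof -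
  let ?U = "\<Union>m\<in>{n..}. dyadic_past_events \<mu> m t"
  have U: "?U \<subseteq> Pow (space \<mu>)"
    unfolding dyadic_past_events_def by (auto dest!: sigma_sets_into_sp[rotated])
  define S where "S = sigma (space \<mu>) ?U"
  have S: "space S = space \<mu>" "sets S = sigma_sets (space \<mu>) ?U" using U by (auto simp: S_def)
  have coord: "(\<lambda>w. w s) \<in> borel_measurable S" if s: "s \<in> {0..t}" for s
  proof (rule borel_measurable_LIMSEQ_metric)
    fix m
    let ?q = "real (nat \<lfloor>s * 2 ^ (m + n)\<rfloor>) / 2 ^ (m + n)"
    have "?q \<le> t" using s by (simp add: field_simps) (smt (verit) mult_right_mono of_int_floor_le zero_le_power)
    have "(\<lambda>w. w ?q) -` A \<inter> space S \<in> sets S" if "A \<in> sets borel" for A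
    proof -
      have "(\<lambda>w. w ?q) -` A \<inter> space S = {w \<in> space \<mu>. w ?q \<in> A}" by (auto simp: S)
      also have "\<dots> \<in> dyadic_past_events \<mu> (m + n) t"
        unfolding dyadic_past_events_def using \<open>?q \<le> t\<close> that by (intro sigma_sets.Basic) blast
      finally show ?thesis unfolding S by (intro sigma_sets.Basic) auto
    qed
    then show "(\<lambda>w. w ?q) \<in> borel_measurable S"
      by (intro measurableI) auto
  next
    fix w assume "w \<in> space S"
    then have "continuous_on {0..1} w" by (simp add: S space_wiener)
    then have "(\<lambda>m. w (real (nat \<lfloor>s * 2 ^ m\<rfloor>) / 2 ^ m)) \<longlonglongrightarrow> w s"
      using s assms by (intro dyadic_floor_tendsto) auto
    then show "(\<lambda>m. w (real (nat \<lfloor>s * 2 ^ (m + n)\<rfloor>) / 2 ^ (m + n))) \<longlonglongrightarrow> w s"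
      by (rule LIMSEQ_ignore_initial_segment)
  qed
  have "past_events \<mu> t \<subseteq> sets S"
    unfolding past_events_def
  proof (rule sets.sigma_sets_subset[of _ S, unfolded S(1)], safe)
    fix s and A :: "(real ^ 'd) set" assume "s \<in> {0..t}" "A \<in> sets borel"
    then show "{w \<in> space \<mu>. w s \<in> A} \<in> sets S"
      using measurable_sets[OF coord[of s], of A] by (simp add: S(1) vimage_def Int_def conj_commute)
  qed
  then show ?thesis by (simp add: S)
qed

text \<open>
  The events observed on some dyadic grid form a family closed under intersection, because the grids are
  nested. Independence therefore extends from this family to the sigma-algebra that it generates.
\<close>
lemma past_indep:
  assumes t': "real k / 2 ^ n \<le> t'" "t' \<le> 1"
    and A: "A \<in> past_events \<mu> (real k / 2 ^ n)" and B: "B \<in> sets borel"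
  shows "prob (A \<inter> ((\<lambda>w. w t' - w (real k / 2 ^ n)) -` B \<inter> space \<mu>))
      = prob A * prob ((\<lambda>w. w t' - w (real k / 2 ^ n)) -` B \<inter> space \<mu>)"
proof -
  let ?t = "real k / 2 ^ n"
  let ?U = "\<Union>m\<in>{n..}. dyadic_past_events \<mu> m ?t"
  let ?E = "(\<lambda>w. w t' - w ?t) -` B \<inter> space \<mu>"
  have "0 \<le> ?t" "?t \<le> 1" using order_trans[OF t'] by auto
  then have t01: "?t \<in> {0..1}" "t' \<in> {0..1}" using t' unfolding atLeastAtMost_iff by linarith+
  have E: "?E \<in> events"
    using B coordinate_measurable[OF t01(1)] coordinate_measurable[OF t01(2)]
    by (intro measurable_sets[of _ \<mu> borel]) auto
  have "indep_set (sigma_sets (space \<mu>) ?U) (sigma_sets (space \<mu>) {?E})"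
  proof (rule indep_set_sigma_sets)
    show "indep_set ?U {?E}"
      by (rule indep_setI) (use E dyadic_past_indep[OF _ t' _ B] in auto)
    show "Int_stable {?E}" by (simp add: Int_stable_def)
    show "Int_stable ?U"
    proof (rule Int_stableI)
      fix a b assume "a \<in> ?U" "b \<in> ?U"
      then obtain m m' where m: "m \<ge> n" "m' \<ge> n" "a \<in> dyadic_past_events \<mu> m ?t" "b \<in> dyadic_past_events \<mu> m' ?t"
        by auto
      then have "a \<in> dyadic_past_events \<mu> (max m m') ?t" "b \<in> dyadic_past_events \<mu> (max m m') ?t"
        using dyadic_past_events_mono[of m "max m m'" \<mu> ?t] dyadic_past_events_mono[of m' "max m m'" \<mu> ?t] by auto
      moreover have "sigma_algebra (space \<mu>) (dyadic_past_events \<mu> (max m m') ?t)"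
        unfolding dyadic_past_events_def by (rule sigma_algebra_sigma_sets) auto
      ultimately have "a \<inter> b \<in> dyadic_past_events \<mu> (max m m') ?t"
        by (meson sigma_algebra.axioms(1) algebra.axioms(1) ring_of_sets.axioms(1) semiring_of_sets.Int)
      then show "a \<inter> b \<in> ?U" using m by auto
    qed
  qed
  then show ?thesis
  proof (rule indep_setD)
    show "A \<in> sigma_sets (space \<mu>) ?U" using past_events_subset_dyadic[of ?t n] t01 A by auto
  qed (auto intro: sigma_sets.Basic)
qed

lemma prob_space_wiener_completion: "prob_space (completion \<mu>)"
  by (rule prob_space_completion)

lemma past_events_sets: "t \<le> 1 \<Longrightarrow> past_events \<mu> t \<subseteq> sets \<mu>"
  unfolding past_events_def
proof (rule sets.sigma_sets_subset, safe)
  fix s and A :: "(real ^ 'd) set" assume "t \<le> 1" "s \<in> {0..t}" "A \<in> sets borel"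
  then show "{w \<in> space \<mu>. w s \<in> A} \<in> sets \<mu>"
    using measurable_sets[OF coordinate_measurable[of s], of A] by (simp add: vimage_def Int_def conj_commute)
qed

lemma
  shows space_completed_filtration: "space (completed_filtration \<mu> t) = space \<mu>"
    and sets_completed_filtration: "sets (completed_filtration \<mu> t) = sigma_sets (space \<mu>)
      ({{w \<in> space \<mu>. w s \<in> A} | s A. s \<in> {0..t} \<and> A \<in> sets borel} \<union> null_sets (completion \<mu>))"
proof -
  have "{{w \<in> space \<mu>. w s \<in> A} | s A. s \<in> {0..t} \<and> A \<in> sets borel} \<union> null_sets (completion \<mu>) \<subseteq> Pow (space \<mu>)"
    using sets.sets_into_space[of _ "completion \<mu>"] by (auto simp: null_sets_def)
  then show "space (completed_filtration \<mu> t) = space \<mu>"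
    "sets (completed_filtration \<mu> t) = sigma_sets (space \<mu>)
      ({{w \<in> space \<mu>. w s \<in> A} | s A. s \<in> {0..t} \<and> A \<in> sets borel} \<union> null_sets (completion \<mu>))"
    by (simp_all add: completed_filtration_def)
qed

lemma completed_filtration_mono:
  "s \<le> t \<Longrightarrow> sets (completed_filtration \<mu> s) \<subseteq> sets (completed_filtration \<mu> t)"
  unfolding sets_completed_filtration by (rule sigma_sets_mono') fastforce

text \<open>
  Completion adds only null sets: the events that agree with an event of the past up to a null set form
  a sigma-algebra.
\<close>
lemma completed_filtration_approx:
  assumes "t \<le> 1" "A \<in> sets (completed_filtration \<mu> t)"
  shows "\<exists>A'\<in>past_events \<mu> t. sym_diff A A' \<in> null_sets (completion \<mu>)"
  using assms(2) unfolding sets_completed_filtration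
proof induction
  case (Basic a)
  then show ?case
  proof
    assume "a \<in> {{w \<in> space \<mu>. w s \<in> A} | s A. s \<in> {0..t} \<and> A \<in> sets borel}"
    then have "a \<in> past_events \<mu> t" unfolding past_events_def by (rule sigma_sets.Basic)
    then show ?thesis by (intro bexI[of _ a]) auto
  next
    assume "a \<in> null_sets (completion \<mu>)"
    moreover have "{} \<in> past_events \<mu> t" unfolding past_events_def by (rule sigma_sets.Empty)
    ultimately show ?thesis by (intro bexI[of _ "{}"]) auto
  qed
next
  case Empty
  have "{} \<in> past_events \<mu> t" unfolding past_events_def by (rule sigma_sets.Empty)
  then show ?case by (intro bexI[of _ "{}"]) auto
next
  case (Compl a)
  then obtain A' where A': "A' \<in> past_events \<mu> t" "sym_diff a A' \<in> null_sets (completion \<mu>)" by auto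
  have "a \<subseteq> space \<mu>" using Compl(1) sets_completed_filtration[of t] space_completed_filtration[of t]
    sets.sets_into_space[of a "completed_filtration \<mu> t"] by auto
  moreover have "A' \<subseteq> space \<mu>" using past_events_sets[OF assms(1)] A'(1) sets.sets_into_space by blast
  ultimately have "sym_diff (space \<mu> - a) (space \<mu> - A') = sym_diff a A'" by auto
  moreover have "space \<mu> - A' \<in> past_events \<mu> t" using A'(1) unfolding past_events_def by (rule sigma_sets.Compl)
  ultimately show ?case using A'(2) by (intro bexI[of _ "space \<mu> - A'"]) auto
next
  case (Union a)
  then obtain A' where A': "\<And>i. A' i \<in> past_events \<mu> t" "\<And>i. sym_diff (a i) (A' i) \<in> null_sets (completion \<mu>)"
    by metis
  have "(\<Union>i. A' i) \<in> past_events \<mu> t" using A'(1) unfolding past_events_def by (rule sigma_sets.Union)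
  moreover have "sym_diff (\<Union>i. a i) (\<Union>i. A' i) \<in> null_sets (completion \<mu>)"
    by (rule null_sets_completion_subset[OF _ null_sets_UN[of "\<lambda>i. sym_diff (a i) (A' i)", OF A'(2)]]) blast
  ultimately show ?case by blast
qed

lemma subalgebra_completed_filtration:
  assumes "t \<le> 1" shows "subalgebra (completion \<mu>) (completed_filtration \<mu> t)"
  unfolding subalgebra_def
proof
  show "space (completed_filtration \<mu> t) = space (completion \<mu>)" by (simp add: space_completed_filtration)
  have "{{w \<in> space \<mu>. w s \<in> A} | s A. s \<in> {0..t} \<and> A \<in> sets borel} \<subseteq> past_events \<mu> t"
    unfolding past_events_def by (rule sigma_sets_superset_generator)
  then show "sets (completed_filtration \<mu> t) \<subseteq> sets (completion \<mu>)"
    using past_events_sets[OF assms] unfolding sets_completed_filtration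
    by (intro sets.sigma_sets_subset[of _ "completion \<mu>", simplified]) auto
qed

lemma completed_filtration_indep:
  assumes t': "real k / 2 ^ n \<le> t'" "t' \<le> 1"
  shows "indep_of_past (completion \<mu>) (completed_filtration \<mu> (real k / 2 ^ n)) (\<lambda>w. w t' - w (real k / 2 ^ n))"
  unfolding indep_of_past_def
proof (intro ballI)
  interpret c: prob_space "completion \<mu>" by (rule prob_space_wiener_completion)
  let ?t = "real k / 2 ^ n"
  fix A and B :: "(real ^ 'd) set" assume A: "A \<in> sets (completed_filtration \<mu> ?t)" and B: "B \<in> sets borel"
  have t01: "0 \<le> ?t" "?t \<le> 1" "0 \<le> t'" using order_trans[OF t'] order_trans[OF _ t'(1)] by auto
  let ?E = "(\<lambda>w. w t' - w ?t) -` B \<inter> space \<mu>"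
  have E: "?E \<in> sets \<mu>"
    using B coordinate_measurable[of ?t] coordinate_measurable[of t'] t01 t'
    by (intro measurable_sets[of _ \<mu> borel] borel_measurable_diff) auto
  obtain A' where A': "A' \<in> past_events \<mu> ?t" and N: "sym_diff A A' \<in> null_sets (completion \<mu>)"
    using completed_filtration_approx[OF t01(2) A] by auto
  have A'_sets: "A' \<in> sets \<mu>" using past_events_sets[OF t01(2)] A' by auto
  have A_sets: "A \<in> sets (completion \<mu>)" using subalgebra_completed_filtration[OF t01(2)] A by (auto simp: subalgebra_def)
  have ae: "AE w in completion \<mu>. w \<notin> sym_diff A A'" by (rule AE_not_in[OF N])
  have "c.prob (A \<inter> ?E) = c.prob (A' \<inter> ?E)"
    by (rule c.finite_measure_eq_AE) (use ae A'_sets A_sets E in auto)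
  moreover have "c.prob A = c.prob A'"
    by (rule c.finite_measure_eq_AE) (use ae A'_sets A_sets in auto)
  ultimately show "c.prob (A \<inter> ((\<lambda>w. w t' - w ?t) -` B \<inter> space (completion \<mu>)))
      = c.prob A * c.prob ((\<lambda>w. w t' - w ?t) -` B \<inter> space (completion \<mu>))"
    using past_indep[OF t' A' B] E A'_sets by simp
qed

end

section \<open>Density of continuous cylinder functionals\<close>

text \<open>
  Measurability is demanded on the full product space because such functionals are also
  evaluated at the discontinuous step paths that interpolate values on a grid.
\<close>
definition cylinder_continuous :: "nat \<Rightarrow> ((real \<Rightarrow> real ^ 'd::finite) \<Rightarrow> real) \<Rightarrow> bool" where
  "cylinder_continuous n \<phi> \<longleftrightarrow>
     \<phi> \<in> borel_measurable (\<Pi>\<^sub>M t\<in>{0..1}. borel) \<and> (\<exists>B. \<forall>w. \<bar>\<phi> w\<bar> \<le> B) \<and>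
     (\<forall>w w'. (\<forall>k\<le>2 ^ n. w (real k / 2 ^ n) = w' (real k / 2 ^ n)) \<longrightarrow> \<phi> w = \<phi> w') \<and>
     (\<forall>X w. (\<forall>t\<in>{0..1}. (\<lambda>m. X m t) \<longlonglongrightarrow> w t) \<longrightarrow> (\<lambda>m. \<phi> (X m)) \<longlonglongrightarrow> \<phi> w)"

lemma cylinder_continuous_const: "cylinder_continuous n (\<lambda>w. c)"
  by (auto simp: cylinder_continuous_def)

lemma cylinder_continuous_mono:
  assumes "cylinder_continuous n \<phi>" "n \<le> n'" shows "cylinder_continuous n' \<phi>"
proof -
  have "(\<forall>k\<le>2 ^ n'. w (real k / 2 ^ n') = w' (real k / 2 ^ n')) \<Longrightarrow> k \<le> 2 ^ n \<Longrightarrow>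
      w (real k / 2 ^ n) = w' (real k / 2 ^ n)" for w w' :: "real \<Rightarrow> real ^ 'a" and k
  proof -
    assume eq: "\<forall>k\<le>2 ^ n'. w (real k / 2 ^ n') = w' (real k / 2 ^ n')" and "k \<le> 2 ^ n"
    then have "k * 2 ^ (n' - n) \<le> 2 ^ n * 2 ^ (n' - n)" by (intro mult_right_mono) auto
    then have "k * 2 ^ (n' - n) \<le> 2 ^ n'" using assms(2) by (simp flip: power_add)
    moreover have "real k / 2 ^ n = real (k * 2 ^ (n' - n)) / 2 ^ n'"
      using assms(2) by (simp add: field_simps flip: power_add)
    ultimately show ?thesis using eq by metis
  qed
  then show ?thesis using assms(1) unfolding cylinder_continuous_def by blast
qed

lemma cylinder_continuous_comp2:
  assumes h: "continuous_on UNIV (\<lambda>z. h (fst z) (snd z))"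
    and \<phi>: "cylinder_continuous n \<phi>" and \<psi>: "cylinder_continuous n \<psi>"
  shows "cylinder_continuous n (\<lambda>w. h (\<phi> w) (\<psi> w) :: real)"
proof -
  obtain B B' where B: "\<And>w. \<bar>\<phi> w\<bar> \<le> B" "\<And>w. \<bar>\<psi> w\<bar> \<le> B'"
    using \<phi> \<psi> unfolding cylinder_continuous_def by auto
  have "compact ((\<lambda>z. h (fst z) (snd z)) ` ({- B..B} \<times> {- B'..B'}))"
    by (intro compact_continuous_image compact_Times continuous_on_subset[OF h]) auto
  then obtain C where "\<forall>y\<in>(\<lambda>z. h (fst z) (snd z)) ` ({- B..B} \<times> {- B'..B'}). norm y \<le> C"
    unfolding bounded_iff[symmetric] using compact_imp_bounded bounded_iff by blast
  then have C: "norm (h (fst z) (snd z)) \<le> C" if "z \<in> {- B..B} \<times> {- B'..B'}" for z using that by blast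
  have "\<bar>h (\<phi> w) (\<psi> w)\<bar> \<le> C" for w
    using C[of "(\<phi> w, \<psi> w)"] B[of w] by (auto simp: abs_le_iff minus_le_iff)
  moreover have "(\<lambda>m. h (\<phi> (X m)) (\<psi> (X m))) \<longlonglongrightarrow> h (\<phi> w) (\<psi> w)"
    if "\<forall>t\<in>{0..1}. (\<lambda>m. X m t) \<longlonglongrightarrow> w t" for X w
  proof -
    have "(\<lambda>m. (\<phi> (X m), \<psi> (X m))) \<longlonglongrightarrow> (\<phi> w, \<psi> w)"
      using that \<phi> \<psi> unfolding cylinder_continuous_def by (intro tendsto_Pair) blast+
    from continuous_on_tendsto_compose[OF h this] show ?thesis by simp
  qed
  moreover have "(\<lambda>w. h (\<phi> w) (\<psi> w)) \<in> borel_measurable (\<Pi>\<^sub>M t\<in>{0..1}. borel)"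
  proof -
    have "(\<lambda>w. (\<phi> w, \<psi> w)) \<in> borel_measurable (\<Pi>\<^sub>M t\<in>{0..1}. borel)"
      using \<phi> \<psi> unfolding cylinder_continuous_def by (intro borel_measurable_Pair) blast+
    from measurable_compose[OF this borel_measurable_continuous_onI[OF h]] show ?thesis by simp
  qed
  moreover have "h (\<phi> w) (\<psi> w) = h (\<phi> w') (\<psi> w')"
    if "\<forall>k\<le>2 ^ n. w (real k / 2 ^ n) = w' (real k / 2 ^ n)" for w w'
    using that \<phi> \<psi> unfolding cylinder_continuous_def by metis
  ultimately show ?thesis unfolding cylinder_continuous_def by blast
qed

text \<open>
  A finite family of probability measures on path space, to be approximated in simultaneously. It will
  consist of Wiener measure and of the law of the shifted path.
\<close>
locale wiener_measures = wiener_measure \<mu> for \<mu> :: "(real \<Rightarrow> real ^ 'd::finite) measure" +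
  fixes R :: "(real \<Rightarrow> real ^ 'd) measure set"
  assumes R_finite: "finite R" and R_prob: "\<And>\<rho>. \<rho> \<in> R \<Longrightarrow> prob_space \<rho>"
    and R_sets: "\<And>\<rho>. \<rho> \<in> R \<Longrightarrow> sets \<rho> = sets \<mu>"
begin

definition approximable :: "((real \<Rightarrow> real ^ 'd) \<Rightarrow> real) \<Rightarrow> bool" where
  "approximable g \<longleftrightarrow> (\<forall>\<epsilon>>0. \<exists>n \<phi>. cylinder_continuous n \<phi> \<and> (\<forall>\<rho>\<in>R. (\<integral>w. \<bar>g w - \<phi> w\<bar> \<partial>\<rho>) < \<epsilon>))"

lemma R_space: "\<rho> \<in> R \<Longrightarrow> space \<rho> = space \<mu>"
  using R_sets by (rule sets_eq_imp_space_eq)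

lemma cylinder_measurable: "cylinder_continuous n \<phi> \<Longrightarrow> \<phi> \<in> borel_measurable \<mu>"
  unfolding cylinder_continuous_def
  by (subst measurable_cong_sets[OF sets_eq refl]) (auto simp: path_space_def intro: measurable_restrict_space1)

lemma R_measurable: "\<rho> \<in> R \<Longrightarrow> g \<in> borel_measurable \<mu> \<Longrightarrow> g \<in> borel_measurable \<rho>"
  using measurable_cong_sets[OF R_sets refl] by blast

lemma R_integrable:
  fixes g :: "(real \<Rightarrow> real ^ 'd) \<Rightarrow> real"
  assumes "\<rho> \<in> R" "g \<in> borel_measurable \<mu>" "\<And>w. w \<in> space \<mu> \<Longrightarrow> \<bar>g w\<bar> \<le> K"
  shows "integrable \<rho> g"
proof -
  interpret \<rho>: prob_space \<rho> by (rule R_prob) fact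
  show ?thesis using R_measurable[OF assms(1,2)] assms(3) R_space[OF assms(1)]
    by (intro \<rho>.integrable_const_bound[of _ K]) auto
qed

lemma cylinder_integrable:
  assumes "\<rho> \<in> R" and \<phi>: "cylinder_continuous n \<phi>"
  shows "integrable \<rho> \<phi>"
proof -
  obtain B where "\<And>w. \<bar>\<phi> w\<bar> \<le> B" using \<phi> unfolding cylinder_continuous_def by blast
  then show ?thesis using assms(1) cylinder_measurable[OF \<phi>] by (intro R_integrable[of _ _ B])
qed

lemma approximable_lipschitz:
  assumes g: "approximable g" "g \<in> borel_measurable \<mu>" and gK: "\<And>w. w \<in> space \<mu> \<Longrightarrow> \<bar>g w\<bar> \<le> K"
    and h: "approximable h" "h \<in> borel_measurable \<mu>" and hK: "\<And>w. w \<in> space \<mu> \<Longrightarrow> \<bar>h w\<bar> \<le> K"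
    and F: "continuous_on UNIV (\<lambda>z. F (fst z) (snd z) :: real)"
    and lip: "\<And>a b a' b'. \<bar>F a b - F a' b'\<bar> \<le> L * \<bar>a - a'\<bar> + L * \<bar>b - b'\<bar>"
  shows "approximable (\<lambda>w. F (g w) (h w))"
  unfolding approximable_def
proof (intro allI impI)
  fix \<epsilon> :: real assume \<epsilon>: "\<epsilon> > 0"
  define L' where "L' = max 1 L"
  have L': "L' > 0" "L \<le> L'" by (auto simp: L'_def)
  define \<delta> where "\<delta> = \<epsilon> / (2 * L')"
  have \<delta>: "\<delta> > 0" using \<epsilon> L' by (simp add: \<delta>_def)
  obtain n \<phi> where \<phi>: "cylinder_continuous n \<phi>" "\<And>\<rho>. \<rho> \<in> R \<Longrightarrow> (\<integral>w. \<bar>g w - \<phi> w\<bar> \<partial>\<rho>) < \<delta>"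
    using g(1) \<delta> unfolding approximable_def by blast
  obtain m \<psi> where \<psi>: "cylinder_continuous m \<psi>" "\<And>\<rho>. \<rho> \<in> R \<Longrightarrow> (\<integral>w. \<bar>h w - \<psi> w\<bar> \<partial>\<rho>) < \<delta>"
    using h(1) \<delta> unfolding approximable_def by blast
  have cyl: "cylinder_continuous (max n m) (\<lambda>w. F (\<phi> w) (\<psi> w))"
    by (rule cylinder_continuous_comp2[OF F])
      (rule cylinder_continuous_mono[OF \<phi>(1)] cylinder_continuous_mono[OF \<psi>(1)]; simp)+
  have "(\<integral>w. \<bar>F (g w) (h w) - F (\<phi> w) (\<psi> w)\<bar> \<partial>\<rho>) < \<epsilon>" if \<rho>: "\<rho> \<in> R" for \<rho>
  proof -
    have i: "integrable \<rho> (\<lambda>w. \<bar>g w - \<phi> w\<bar>)" "integrable \<rho> (\<lambda>w. \<bar>h w - \<psi> w\<bar>)"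
      using R_integrable[OF \<rho> g(2) gK] R_integrable[OF \<rho> h(2) hK]
        cylinder_integrable[OF \<rho> \<phi>(1)] cylinder_integrable[OF \<rho> \<psi>(1)]
      by (auto intro!: integrable_abs)
    have "(\<integral>w. \<bar>F (g w) (h w) - F (\<phi> w) (\<psi> w)\<bar> \<partial>\<rho>) \<le> (\<integral>w. L' * \<bar>g w - \<phi> w\<bar> + L' * \<bar>h w - \<psi> w\<bar> \<partial>\<rho>)"
    proof (rule integral_mono')
      show "integrable \<rho> (\<lambda>w. L' * \<bar>g w - \<phi> w\<bar> + L' * \<bar>h w - \<psi> w\<bar>)" using i by simp
      fix w
      show "\<bar>F (g w) (h w) - F (\<phi> w) (\<psi> w)\<bar> \<le> L' * \<bar>g w - \<phi> w\<bar> + L' * \<bar>h w - \<psi> w\<bar>"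
        using lip[of "g w" "h w" "\<phi> w" "\<psi> w"] mult_right_mono[OF L'(2), of "\<bar>g w - \<phi> w\<bar>"]
          mult_right_mono[OF L'(2), of "\<bar>h w - \<psi> w\<bar>"] by linarith
    qed (use L' in auto)
    also have "\<dots> = L' * (\<integral>w. \<bar>g w - \<phi> w\<bar> \<partial>\<rho>) + L' * (\<integral>w. \<bar>h w - \<psi> w\<bar> \<partial>\<rho>)"
      using i by simp
    also have "\<dots> < L' * \<delta> + L' * \<delta>"
      using L' \<phi>(2)[OF \<rho>] \<psi>(2)[OF \<rho>] by (intro add_strict_mono mult_strict_left_mono) auto
    also have "\<dots> = \<epsilon>" using L' by (simp add: \<delta>_def)
    finally show ?thesis .
  qed
  then show "\<exists>n \<phi>. cylinder_continuous n \<phi> \<and> (\<forall>\<rho>\<in>R. (\<integral>w. \<bar>F (g w) (h w) - \<phi> w\<bar> \<partial>\<rho>) < \<epsilon>)"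
    using cyl by blast
qed

lemma approximable_limit:
  assumes g: "\<And>i. approximable (g i)" "\<And>i. g i \<in> borel_measurable \<mu>" "\<And>i w. w \<in> space \<mu> \<Longrightarrow> \<bar>g i w\<bar> \<le> K"
    and h: "h \<in> borel_measurable \<mu>" and lim: "\<And>w. w \<in> space \<mu> \<Longrightarrow> (\<lambda>i. g i w) \<longlonglongrightarrow> h w"
  shows "approximable h"
  unfolding approximable_def
proof (intro allI impI)
  fix \<epsilon> :: real assume \<epsilon>: "\<epsilon> > 0"
  have hK: "\<bar>h w\<bar> \<le> K" if "w \<in> space \<mu>" for w
    using tendsto_rabs[OF lim[OF that]] by (rule LIMSEQ_le_const2) (use g(3) that in auto)
  have "\<forall>\<^sub>F i in sequentially. \<forall>\<rho>\<in>R. (\<integral>w. \<bar>h w - g i w\<bar> \<partial>\<rho>) < \<epsilon> / 2"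
  proof (rule eventually_ball_finite[OF R_finite], intro ballI)
    fix \<rho> assume \<rho>: "\<rho> \<in> R"
    interpret \<rho>: prob_space \<rho> by (rule R_prob) fact
    have "(\<lambda>i. \<integral>w. \<bar>h w - g i w\<bar> \<partial>\<rho>) \<longlonglongrightarrow> (\<integral>w. 0 \<partial>\<rho>)"
    proof (rule integral_dominated_convergence)
      show "integrable \<rho> (\<lambda>_. 2 * K)" by simp
      show "AE w in \<rho>. (\<lambda>i. \<bar>h w - g i w\<bar>) \<longlonglongrightarrow> 0"
      proof (rule AE_I2)
        fix w assume "w \<in> space \<rho>"
        then have "(\<lambda>i. \<bar>h w - g i w\<bar>) \<longlonglongrightarrow> \<bar>h w - h w\<bar>" using R_space[OF \<rho>] lim by (intro tendsto_intros) auto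
        then show "(\<lambda>i. \<bar>h w - g i w\<bar>) \<longlonglongrightarrow> 0" by simp
      qed
      show "AE w in \<rho>. norm \<bar>h w - g i w\<bar> \<le> 2 * K" for i
      proof (rule AE_I2)
        fix w assume "w \<in> space \<rho>"
        then show "norm \<bar>h w - g i w\<bar> \<le> 2 * K" using hK[of w] g(3)[of w i] R_space[OF \<rho>] by (simp add: abs_le_iff)
      qed
    qed (use R_measurable[OF \<rho>] h g(2) in \<open>auto intro!: borel_measurable_abs borel_measurable_diff\<close>)
    then show "\<forall>\<^sub>F i in sequentially. (\<integral>w. \<bar>h w - g i w\<bar> \<partial>\<rho>) < \<epsilon> / 2"
      using \<epsilon> by (intro order_tendstoD(2)[of _ 0]) auto
  qed
  then obtain i where i: "\<And>\<rho>. \<rho> \<in> R \<Longrightarrow> (\<integral>w. \<bar>h w - g i w\<bar> \<partial>\<rho>) < \<epsilon> / 2"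
    by (auto simp: eventually_sequentially)
  obtain n \<phi> where \<phi>: "cylinder_continuous n \<phi>" "\<And>\<rho>. \<rho> \<in> R \<Longrightarrow> (\<integral>w. \<bar>g i w - \<phi> w\<bar> \<partial>\<rho>) < \<epsilon> / 2"
    using g(1)[of i] \<epsilon> unfolding approximable_def by (meson half_gt_zero)
  have "(\<integral>w. \<bar>h w - \<phi> w\<bar> \<partial>\<rho>) < \<epsilon>" if \<rho>: "\<rho> \<in> R" for \<rho>
  proof -
    have int: "integrable \<rho> h" "integrable \<rho> (g i)" "integrable \<rho> \<phi>"
      using R_integrable[OF \<rho> h hK] R_integrable[OF \<rho> g(2,3)] cylinder_integrable[OF \<rho> \<phi>(1)] by auto
    then have "(\<integral>w. \<bar>h w - \<phi> w\<bar> \<partial>\<rho>) \<le> (\<integral>w. \<bar>h w - g i w\<bar> + \<bar>g i w - \<phi> w\<bar> \<partial>\<rho>)"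
      by (intro integral_mono) auto
    also have "\<dots> = (\<integral>w. \<bar>h w - g i w\<bar> \<partial>\<rho>) + (\<integral>w. \<bar>g i w - \<phi> w\<bar> \<partial>\<rho>)"
      using int by (intro Bochner_Integration.integral_add) auto
    also have "\<dots> < \<epsilon>" using i[OF \<rho>] \<phi>(2)[OF \<rho>] by simp
    finally show ?thesis .
  qed
  then show "\<exists>n \<phi>. cylinder_continuous n \<phi> \<and> (\<forall>\<rho>\<in>R. (\<integral>w. \<bar>h w - \<phi> w\<bar> \<partial>\<rho>) < \<epsilon>)"
    using \<phi>(1) by blast
qed

lemma approximable_cylinder:
  assumes "cylinder_continuous n \<phi>" shows "approximable \<phi>"
  unfolding approximable_def
proof (intro allI impI)
  fix \<epsilon> :: real assume "\<epsilon> > 0"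
  then show "\<exists>n \<psi>. cylinder_continuous n \<psi> \<and> (\<forall>\<rho>\<in>R. (\<integral>w. \<bar>\<phi> w - \<psi> w\<bar> \<partial>\<rho>) < \<epsilon>)"
    using assms by (intro exI[of _ n] exI[of _ \<phi>]) simp
qed

lemma approximable_affine:
  assumes g: "approximable g" "g \<in> borel_measurable \<mu>" "\<And>w. w \<in> space \<mu> \<Longrightarrow> \<bar>g w\<bar> \<le> K"
  shows "approximable (\<lambda>w. c + d * g w)"
proof (rule approximable_lipschitz[OF g g, where L = "\<bar>d\<bar>" and F = "\<lambda>a _. c + d * a"])
  show "continuous_on UNIV (\<lambda>z :: real \<times> real. c + d * fst z)" by (intro continuous_intros)
  show "\<bar>c + d * a - (c + d * a')\<bar> \<le> \<bar>d\<bar> * \<bar>a - a'\<bar> + \<bar>d\<bar> * \<bar>b - b'\<bar>" for a b a' b'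
  proof -
    have "c + d * a - (c + d * a') = d * (a - a')" by (simp add: algebra_simps)
    then show ?thesis by (simp add: abs_mult)
  qed
qed

definition closed_coordinate_sets :: "(real \<Rightarrow> real ^ 'd) set set" where
  "closed_coordinate_sets = {{w \<in> space \<mu>. w (real k / 2 ^ n) \<in> C} | k n C. k \<le> 2 ^ n \<and> closed C}"

text \<open>
  The indicator of a closed set is the pointwise limit of the functions \<open>max 0 (1 - j d)\<close>, where \<open>d\<close> is the
  distance from the set.
\<close>
lemma approximable_closed_coordinate:
  assumes k: "k \<le> 2 ^ n" and C: "closed C"
  shows "approximable (indicator {w \<in> space \<mu>. w (real k / 2 ^ n) \<in> C})"
proof (cases "C = {}")
  case True
  then have "indicator {w \<in> space \<mu>. w (real k / 2 ^ n) \<in> C} = (\<lambda>w. 0 :: real)" by (auto simp: fun_eq_iff)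
  then show ?thesis using approximable_cylinder[OF cylinder_continuous_const[of n 0]] by simp
next
  case False
  let ?q = "real k / 2 ^ n"
  have q: "?q \<in> {0..1}" using k by simp
  define \<phi> where "\<phi> j w = max 0 (1 - real j * infdist (w ?q) C)" for j and w :: "real \<Rightarrow> real ^ 'd"
  have \<phi>_bound: "\<bar>\<phi> j w\<bar> \<le> 1" for j w by (simp add: \<phi>_def infdist_nonneg)
  have coord: "(\<lambda>w. w ?q) \<in> borel_measurable (\<Pi>\<^sub>M t\<in>{0..1}. borel)"
    using q by (rule measurable_component_singleton)
  have \<phi>: "cylinder_continuous n (\<phi> j)" for j
    unfolding cylinder_continuous_def
  proof (intro conjI allI impI)
    have "continuous_on UNIV (\<lambda>x. max 0 (1 - real j * infdist x C))" by (intro continuous_intros)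
    from measurable_compose[OF coord borel_measurable_continuous_onI[OF this]]
    show "\<phi> j \<in> borel_measurable (\<Pi>\<^sub>M t\<in>{0..1}. borel)" by (simp add: \<phi>_def[abs_def])
    show "\<exists>B. \<forall>w. \<bar>\<phi> j w\<bar> \<le> B" using \<phi>_bound by blast
    show "\<phi> j w = \<phi> j w'" if "\<forall>k\<le>2 ^ n. w (real k / 2 ^ n) = w' (real k / 2 ^ n)" for w w'
      using that k by (simp add: \<phi>_def)
    show "(\<lambda>m. \<phi> j (X m)) \<longlonglongrightarrow> \<phi> j w" if "\<forall>t\<in>{0..1}. (\<lambda>m. X m t) \<longlonglongrightarrow> w t" for X w
    proof -
      have "(\<lambda>m. X m ?q) \<longlonglongrightarrow> w ?q" using that q by blast
      then show ?thesis unfolding \<phi>_def by (intro tendsto_intros)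
    qed
  qed
  show ?thesis
  proof (rule approximable_limit[of \<phi> 1])
    show "approximable (\<phi> i)" for i using \<phi> by (rule approximable_cylinder)
    show "\<phi> i \<in> borel_measurable \<mu>" for i using \<phi> by (rule cylinder_measurable)
    show "\<bar>\<phi> i w\<bar> \<le> 1" for i w by (rule \<phi>_bound)
    have "{w \<in> space \<mu>. w ?q \<in> C} \<in> sets \<mu>"
      using measurable_sets_Collect[OF coordinate_measurable[OF q], of "\<lambda>x. x \<in> C"] borel_closed[OF C] by simp
    then show "indicator {w \<in> space \<mu>. w ?q \<in> C} \<in> borel_measurable \<mu>" by simp
    fix w assume w: "w \<in> space \<mu>"
    show "(\<lambda>i. \<phi> i w) \<longlonglongrightarrow> indicator {w \<in> space \<mu>. w ?q \<in> C} w"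
    proof (cases "w ?q \<in> C")
      case True
      then show ?thesis using w by (simp add: \<phi>_def)
    next
      case outside: False
      then have pos: "infdist (w ?q) C > 0" using infdist_pos_not_in_closed[OF C False] by simp
      obtain J :: nat where J: "1 / infdist (w ?q) C < real J" using reals_Archimedean2 by blast
      have "\<phi> i w = 0" if "i \<ge> J" for i
      proof -
        have "1 / infdist (w ?q) C < real i" using J that by linarith
        then show ?thesis using pos by (simp add: \<phi>_def field_simps)
      qed
      then show ?thesis using outside
        by (intro tendsto_eventually eventually_sequentiallyI[of J]) (auto simp: indicator_def)
    qed
  qed
qed

text \<open>
  A path is determined by its dyadic positions, and every coordinate is a limit of these.
\<close>
lemma sets_closed_coordinate: "sets \<mu> \<subseteq> sigma_sets (space \<mu>) closed_coordinate_sets"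
proof -
  have G: "closed_coordinate_sets \<subseteq> Pow (space \<mu>)" by (auto simp: closed_coordinate_sets_def)
  define S where "S = sigma (space \<mu>) closed_coordinate_sets"
  have S: "space S = space \<mu>" "sets S = sigma_sets (space \<mu>) closed_coordinate_sets"
    using G by (auto simp: S_def)
  have grid: "(\<lambda>w. w (real k / 2 ^ n)) \<in> borel_measurable S" if "k \<le> 2 ^ n" for k n
    unfolding borel_eq_closed
  proof (rule measurable_measure_of)
    fix C :: "(real ^ 'd) set" assume "C \<in> Collect closed"
    then have "{w \<in> space \<mu>. w (real k / 2 ^ n) \<in> C} \<in> sets S"
      unfolding S closed_coordinate_sets_def using that by (intro sigma_sets.Basic) blast
    then show "(\<lambda>w. w (real k / 2 ^ n)) -` C \<inter> space S \<in> sets S"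
      by (simp add: S vimage_def Int_def conj_commute)
  qed auto
  have "(\<lambda>w. w) \<in> measurable S \<mu>"
  proof (rule measurable_into_wiener)
    fix t :: real assume t: "t \<in> {0..1}"
    show "(\<lambda>w. w t) \<in> borel_measurable S"
    proof (rule borel_measurable_LIMSEQ_metric)
      fix m
      have "real (nat \<lfloor>t * 2 ^ m\<rfloor>) \<le> 2 ^ m"
      proof -
        have "real (nat \<lfloor>t * 2 ^ m\<rfloor>) \<le> t * 2 ^ m" using t by simp
        also have "\<dots> \<le> 2 ^ m" using t by simp
        finally show ?thesis .
      qed
      then have "nat \<lfloor>t * 2 ^ m\<rfloor> \<le> 2 ^ m" by (metis of_nat_le_iff of_nat_numeral of_nat_power)
      then show "(\<lambda>w. w (real (nat \<lfloor>t * 2 ^ m\<rfloor>) / 2 ^ m)) \<in> borel_measurable S" by (rule grid)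
    next
      fix w assume "w \<in> space S"
      then show "(\<lambda>m. w (real (nat \<lfloor>t * 2 ^ m\<rfloor>) / 2 ^ m)) \<longlonglongrightarrow> w t"
        using t by (intro dyadic_floor_tendsto) (auto simp: S space_wiener)
    qed
  qed (simp add: S)
  then have "A \<in> sets S" if "A \<in> sets \<mu>" for A
    using measurable_sets[of "\<lambda>w. w" S \<mu> A] that sets.sets_into_space[OF that] by (simp add: S(1) Int_absorb2)
  then show ?thesis using S(2) by blast
qed

text \<open>
  The sets with approximable indicator contain the generators and form a sigma-algebra: complements are
  affine images, finite unions are maxima, and countable unions are limits of finite ones.
\<close>
lemma approximable_indicator:
  assumes "A \<in> sets \<mu>" shows "approximable (indicator A)"
proof -
  have "A \<in> sigma_sets (space \<mu>) closed_coordinate_sets" using assms sets_closed_coordinate by blast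
  then have "A \<in> sets \<mu> \<and> approximable (indicator A)"
  proof induction
    case (Basic a)
    then obtain k n C where a: "a = {w \<in> space \<mu>. w (real k / 2 ^ n) \<in> C}" "k \<le> 2 ^ n" "closed C"
      unfolding closed_coordinate_sets_def by blast
    have "real k / 2 ^ n \<in> {0..1}" using a(2) by simp
    then have "a \<in> sets \<mu>" unfolding a(1)
      using measurable_sets_Collect[OF coordinate_measurable, of _ "\<lambda>x. x \<in> C"] borel_closed[OF a(3)] by simp
    then show ?case using approximable_closed_coordinate[OF a(2,3)] a(1) by simp
  next
    case Empty
    then show ?case using approximable_cylinder[OF cylinder_continuous_const[of 0 0]] by (simp add: indicator_def)
  next
    case (Compl a)
    then have a: "a \<in> sets \<mu>" "approximable (indicator a)" by auto
    have "approximable (\<lambda>w. 1 + (- 1) * indicator a w)"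
      by (rule approximable_affine[OF a(2), where K = 1]) (use a(1) in \<open>auto simp: indicator_def\<close>)
    then have "approximable (indicator (space \<mu> - a))"
      by (rule approximable_limit[of "\<lambda>_ w. 1 + (- 1) * indicator a w" 1])
        (use a in \<open>auto simp: indicator_def\<close>)
    then show ?case using a by auto
  next
    case (Union a)
    then have a: "\<And>i. a i \<in> sets \<mu>" "\<And>i. approximable (indicator (a i))" by auto
    have fin: "approximable (indicator (\<Union>i<N. a i))" for N :: nat
    proof (induction N)
      case 0
      then show ?case using approximable_cylinder[OF cylinder_continuous_const[of 0 0]] by (simp add: indicator_def)
    next
      case (Suc N)
      have "approximable (\<lambda>w. max (indicator (\<Union>i<N. a i) w) (indicator (a N) w))"
      proof (rule approximable_lipschitz[OF Suc _ _ a(2), where L = 1 and K = 1 and F = max])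
        show "continuous_on UNIV (\<lambda>z :: real \<times> real. max (fst z) (snd z) :: real)" by (intro continuous_intros)
      qed (use a in \<open>auto simp: indicator_def max_def abs_if\<close>)
      moreover have "(\<lambda>w. max (indicator (\<Union>i<N. a i) w) (indicator (a N) w)) = (indicator (\<Union>i<Suc N. a i) :: _ \<Rightarrow> real)"
        by (auto simp: fun_eq_iff indicator_def less_Suc_eq)
      ultimately show ?case by simp
    qed
    have "approximable (indicator (\<Union>i. a i))"
    proof (rule approximable_limit[of "\<lambda>N. indicator (\<Union>i<N. a i)" 1, OF fin])
      show "(\<lambda>N. indicator (\<Union>i<N. a i) w :: real) \<longlonglongrightarrow> indicator (\<Union>i. a i) w" for w
        by (rule LIMSEQ_indicator_UN)
    qed (use a in \<open>auto simp: indicator_def\<close>)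
    then show ?case using a by auto
  qed
  then show ?thesis by blast
qed

proposition bounded_approximable:
  assumes g: "g \<in> borel_measurable \<mu>" and K: "\<And>w. \<bar>g w\<bar> \<le> K"
  shows "approximable g"
proof -
  have pos: "(\<And>w. w \<in> space \<mu> \<Longrightarrow> u w \<le> B) \<Longrightarrow> approximable u"
    if "u \<in> borel_measurable \<mu>" "\<And>w. 0 \<le> u w" for u B
    using that
  proof (induction arbitrary: B rule: borel_measurable_induct_real)
    case (set A)
    then show ?case by (intro approximable_indicator)
  next
    case (mult u c)
    show ?case
    proof (cases "c = 0")
      case True
      then show ?thesis using approximable_cylinder[OF cylinder_continuous_const[of 0 0]] by simp
    next
      case False
      then have c: "c > 0" using mult by simp
      have b: "u w \<le> B / c" if "w \<in> space \<mu>" for w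
        using mult.prems[OF that] c by (simp add: field_simps)
      have "approximable (\<lambda>w. 0 + c * u w)"
      proof (rule approximable_affine[where K = "B / c"])
        show "approximable u" using b by (rule mult.IH)
        show "\<bar>u w\<bar> \<le> B / c" if "w \<in> space \<mu>" for w using b[OF that] mult.hyps(3)[of w] by simp
      qed (rule mult.hyps)
      then show ?thesis by simp
    qed
  next
    case (add u v)
    have b: "u w \<le> B" "v w \<le> B" if "w \<in> space \<mu>" for w
      using add.prems[OF that] add.hyps(2,4)[of w] by auto
    show ?case
    proof (rule approximable_lipschitz[where L = 1 and K = B and F = "(+)"])
      show "continuous_on UNIV (\<lambda>z :: real \<times> real. fst z + snd z :: real)" by (intro continuous_intros)
      show "approximable u" "approximable v" using b by (auto intro!: add.IH)
      show "\<bar>u w\<bar> \<le> B" "\<bar>v w\<bar> \<le> B" if "w \<in> space \<mu>" for w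
        using b[OF that] add.hyps(2,4)[of w] by auto
    qed (auto intro: add.hyps)
  next
    case (seq U)
    have b: "U i w \<le> B" if "w \<in> space \<mu>" for i w
    proof -
      have "U i w \<le> u w"
        using seq.hyps(3,4) that by (intro incseq_le) (auto simp: incseq_def le_fun_def)
      then show ?thesis using seq.prems[OF that] by simp
    qed
    show ?case
    proof (rule approximable_limit[of U B])
      show "approximable (U i)" for i using b by (rule seq.IH)
      show "\<bar>U i w\<bar> \<le> B" if "w \<in> space \<mu>" for i w using b[OF that] seq.hyps(2)[of i w] by simp
    qed (use seq.hyps that in auto)
  qed
  have "approximable (\<lambda>w. g w + K)"
  proof (rule pos[of "\<lambda>w. g w + K" "2 * K"])
    show "(\<lambda>w. g w + K) \<in> borel_measurable \<mu>" using g by simp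
    show "0 \<le> g w + K" "g w + K \<le> 2 * K" for w using K[of w] by auto
  qed
  then have "approximable (\<lambda>w. - K + 1 * (g w + K))"
  proof (rule approximable_affine[where K = "2 * K"])
    show "(\<lambda>w. g w + K) \<in> borel_measurable \<mu>" using g by simp
    show "\<bar>g w + K\<bar> \<le> 2 * K" for w using K[of w] by auto
  qed
  then show ?thesis by simp
qed

end

section \<open>Cameron--Martin paths\<close>

text \<open>
  Half-lines are closed under intersection and generate the Borel sets, so all integrals of \<open>d\<close> over Borel
  sets vanish.
\<close>
lemma AE_zero_of_integrals_over_half_lines:
  fixes d :: "real \<Rightarrow> 'b::{second_countable_topology, banach}"
  assumes d: "integrable lborel d" and zero: "\<And>t. (LINT s:{..t}|lborel. d s) = 0" and total: "(\<integral>s. d s \<partial>lborel) = 0"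
  shows "AE s in lborel. d s = 0"
proof (rule sigma_finite_measure.density_zero[OF lborel.sigma_finite_measure_axioms d])
  fix A :: "real set" assume "A \<in> sets lborel"
  then have A: "A \<in> sigma_sets UNIV (range atMost)" by (simp add: borel_eq_atMost)
  have "Int_stable (range atMost :: real set set)"
    by (rule Int_stableI) auto
  moreover have "range atMost \<subseteq> Pow (UNIV :: real set)" by simp
  moreover note A
  ultimately   show "(LINT s:A|lborel. d s) = 0"
  proof (induction rule: sigma_sets_induct_disjoint)
    case (basic A)
    then show ?case using zero by auto
  next
    case empty
    then show ?case by (simp add: set_lebesgue_integral_def)
  next
    case (compl A)
    have A: "A \<in> sets lborel" using compl(1) by (simp add: borel_eq_atMost)
    have i: "set_integrable lborel B d" if "B \<in> sets lborel" for B
      unfolding set_integrable_def using d that by (rule integrable_mult_indicator[rotated])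
    have "(LINT s:A \<union> (UNIV - A)|lborel. d s) = (LINT s:A|lborel. d s) + (LINT s:UNIV - A|lborel. d s)"
      by (rule set_integral_Un) (use A in \<open>auto intro!: i\<close>)
    moreover have "A \<union> (UNIV - A) = UNIV" by auto
    ultimately show ?case using compl(2) total by (simp add: set_lebesgue_integral_def)
  next
    case (union A)
    have A: "A i \<in> sets lborel" for i using union(2) by (auto simp: borel_eq_atMost)
    have i: "set_integrable lborel (\<Union>i. A i) d"
      unfolding set_integrable_def using A by (intro integrable_mult_indicator d) auto
    have "(LINT s:(\<Union>i. A i)|lborel. d s) = (\<Sum>i. LINT s:A i|lborel. d s)"
      by (rule lebesgue_integral_countable_add[OF A _ i]) (use union(1) in \<open>auto simp: disjoint_family_on_def\<close>)
    then show ?case using union(3) by simp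
  qed
qed

lemma cm_deriv_integrable:
  assumes "cm_deriv h g" "A \<in> sets borel" "A \<subseteq> {0..1}"
  shows "set_integrable lborel A g" "set_integrable lborel A (\<lambda>s. (norm (g s))\<^sup>2)"
  using assms unfolding cm_deriv_def by (auto elim: set_integrable_subset)

lemma cm_deriv_cong:
  assumes g: "cm_deriv h g" and eq: "\<And>s. s \<in> {0..1} \<Longrightarrow> g s = g' s"
  shows "cm_deriv h g'"
  unfolding cm_deriv_def
proof (intro conjI ballI)
  show "set_integrable lborel {0..1} g'"
    using cm_deriv_integrable(1)[OF g, of "{0..1}"] by (rule set_integrable_cong[THEN iffD1, rotated 3]) (auto simp: eq)
  show "set_integrable lborel {0..1} (\<lambda>s. (norm (g' s))\<^sup>2)"
    using cm_deriv_integrable(2)[OF g, of "{0..1}"] by (rule set_integrable_cong[THEN iffD1, rotated 3]) (auto simp: eq)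
  fix t :: real assume t: "t \<in> {0..1}"
  then have "h t = (LINT s:{0..t}|lborel. g s)" using g by (simp add: cm_deriv_def)
  also have "\<dots> = (LINT s:{0..t}|lborel. g' s)"
    using t by (intro set_lebesgue_integral_cong) (auto simp: eq)
  finally show "h t = (LINT s:{0..t}|lborel. g' s)" .
qed

lemma cm_deriv_unique:
  assumes g: "cm_deriv h g" and g': "cm_deriv h g'"
  shows "AE s in lborel. s \<in> {0..1} \<longrightarrow> g s = g' s"
proof -
  define d where "d s = indicator {0..1} s *\<^sub>R (g s - g' s)" for s :: real
  have d: "integrable lborel d"
    using set_integral_diff(1)[of lborel "{0..1}" g g'] g g'
    unfolding cm_deriv_def d_def set_integrable_def by auto
  have *: "(LINT s:A|lborel. d s) = 0" if A: "A \<inter> {0..1} = {0..t}" "t \<in> {0..1}" for A t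
  proof -
    have "(LINT s:A|lborel. d s) = (LINT s:{0..t}|lborel. g s - g' s)"
      unfolding set_lebesgue_integral_def d_def A(1)[symmetric] by (simp add: indicator_inter_arith mult.commute)
    also have "\<dots> = (LINT s:{0..t}|lborel. g s) - (LINT s:{0..t}|lborel. g' s)"
      using that by (intro set_integral_diff cm_deriv_integrable[OF g] cm_deriv_integrable[OF g']) auto
    also have "\<dots> = 0" using g g' that unfolding cm_deriv_def by simp
    finally show ?thesis .
  qed
  have "AE s in lborel. d s = 0"
  proof (rule AE_zero_of_integrals_over_half_lines[OF d])
    show "(LINT s:{..t}|lborel. d s) = 0" for t
    proof (cases "t < 0")
      case True
      then have "(\<lambda>s. indicator {..t} s *\<^sub>R d s) = (\<lambda>s. 0)" by (auto simp: d_def indicator_def)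
      then show ?thesis by (simp add: set_lebesgue_integral_def)
    next
      case False
      then show ?thesis by (intro *[of _ "min t 1"]) auto
    qed
    show "(\<integral>s. d s \<partial>lborel) = 0" using *[of UNIV 1] by (simp add: set_lebesgue_integral_def)
  qed
  then show ?thesis by eventually_elim (auto simp: d_def)
qed

text \<open>
  The value of \<open>cm_norm_sq\<close> does not depend on the derivative that the choice operator picks.
\<close>
lemma cm_norm_sq_eq:
  assumes g: "cm_deriv h g"
  shows "cm_norm_sq h = (LINT s:{0..1}|lborel. (norm (g s))\<^sup>2)"
proof -
  let ?g' = "SOME g. cm_deriv h g"
  have meas: "(\<lambda>x. indicator {0..1} x *\<^sub>R (norm (g x))\<^sup>2) \<in> borel_measurable lborel" if "cm_deriv h g" for g
    using that unfolding cm_deriv_def set_integrable_def by (auto dest: borel_measurable_integrable)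
  have g': "cm_deriv h ?g'" by (rule someI[of "cm_deriv h", OF g])
  show ?thesis unfolding cm_norm_sq_def set_lebesgue_integral_def
  proof (rule integral_cong_AE)
    show "AE x in lborel. indicator {0..1} x *\<^sub>R (norm (?g' x))\<^sup>2 = indicator {0..1} x *\<^sub>R (norm (g x))\<^sup>2"
      using cm_deriv_unique[OF g' g] by eventually_elim (auto simp: indicator_def)
  qed (rule meas[OF g'], rule meas[OF g])
qed

lemma cm_deriv_continuous:
  assumes g: "cm_deriv h g" shows "continuous_on {0..1} h"
proof -
  have "g integrable_on {0..1}"
    by (rule set_borel_integral_eq_integral) (rule cm_deriv_integrable[OF g]; simp)
  then have "continuous_on {0..1} (\<lambda>t. integral {0..t} g)" by (rule indefinite_integral_continuous_1)
  moreover have "h t = integral {0..t} g" if "t \<in> {0..1}" for t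
  proof -
    have "h t = (LINT s:{0..t}|lborel. g s)" using g that by (simp add: cm_deriv_def)
    also have "\<dots> = integral {0..t} g"
      by (rule set_borel_integral_eq_integral) (rule cm_deriv_integrable[OF g]; use that in auto)
    finally show ?thesis .
  qed
  ultimately show ?thesis by (subst continuous_on_cong[OF refl, of _ h]) auto
qed

lemma cm_deriv_zero: assumes "cm_deriv h g" shows "h 0 = 0"
proof -
  have "h 0 = (LINT s:{0..0}|lborel. g s)" using assms by (simp add: cm_deriv_def)
  also have "\<dots> = 0" unfolding set_lebesgue_integral_def
    by (intro integral_eq_zero_AE AE_I[of _ _ "{0}"]) (auto simp: indicator_def)
  finally show ?thesis .
qed

text \<open>
  The Cauchy--Schwarz inequality against the constant function one.
\<close>
lemma norm_set_integral_sq_le: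
  fixes g :: "real \<Rightarrow> 'b::{second_countable_topology, banach}"
  assumes st: "s < t" and g: "set_integrable lborel {s<..t} g" and g2: "set_integrable lborel {s<..t} (\<lambda>r. (norm (g r))\<^sup>2)"
  shows "(norm (LINT r:{s<..t}|lborel. g r))\<^sup>2 \<le> (t - s) * (LINT r:{s<..t}|lborel. (norm (g r))\<^sup>2)"
proof -
  let ?I = "{s<..t}"
  let ?a = "LINT r:?I|lborel. norm (g r)"
  define c where "c = ?a / (t - s)"
  have gn: "set_integrable lborel ?I (\<lambda>r. norm (g r))"
    using g by (rule set_integrable_norm)
  have one: "set_integrable lborel ?I (\<lambda>r. 1::real)" using st by (simp add: set_integrable_def integrable_indicator_iff)
  \<comment> \<open>\<open>c\<close> is the mean of \<open>norm \<circ> g\<close>, so this expresses that its variance is nonnegative\<close>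
  have "0 \<le> (LINT r:?I|lborel. (norm (g r) - c)\<^sup>2)"
    unfolding set_lebesgue_integral_def by (rule Bochner_Integration.integral_nonneg) auto
  also have "\<dots> = (LINT r:?I|lborel. (norm (g r))\<^sup>2 - 2 * c * norm (g r) + c\<^sup>2 * 1)"
    by (rule set_lebesgue_integral_cong) (auto simp: power2_diff)
  also have "\<dots> = (LINT r:?I|lborel. (norm (g r))\<^sup>2) - 2 * c * ?a + c\<^sup>2 * (LINT r:?I|lborel. 1)"
  proof -
    have gnc: "set_integrable lborel ?I (\<lambda>r. 2 * c * norm (g r))" using gn by simp
    have onec: "set_integrable lborel ?I (\<lambda>r. c\<^sup>2 * 1)" using one by (rule set_integrable_mult_right)
    show ?thesis
      by (simp only: set_integral_add(2)[OF set_integral_diff(1)[OF g2 gnc] onec]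
          set_integral_diff(2)[OF g2 gnc] set_integral_mult_right)
  qed
  also have "(LINT r:?I|lborel. 1) = t - s" using st by (simp add: set_lebesgue_integral_def)
  also have "(LINT r:?I|lborel. (norm (g r))\<^sup>2) - 2 * c * ?a + c\<^sup>2 * (t - s)
      = (LINT r:?I|lborel. (norm (g r))\<^sup>2) - ?a\<^sup>2 / (t - s)"
  proof -
    have "c * (t - s) = ?a" using st by (simp add: c_def)
    then have "2 * c * ?a - c\<^sup>2 * (t - s) = c * ?a" by (simp add: power2_eq_square algebra_simps)
    also have "c * ?a = ?a\<^sup>2 / (t - s)" by (simp add: c_def power2_eq_square)
    finally show ?thesis by simp
  qed
  finally have "?a\<^sup>2 \<le> (t - s) * (LINT r:?I|lborel. (norm (g r))\<^sup>2)"
    using st by (simp add: field_simps)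
  moreover have "norm (LINT r:?I|lborel. g r) \<le> ?a" using g by (rule set_integral_norm_bound)
  ultimately show ?thesis by (meson norm_ge_zero order_trans power_mono)
qed

lemma cm_increment_sq_le:
  assumes g: "cm_deriv h g" and st: "0 \<le> s" "s < t" "t \<le> 1"
  shows "(norm (h t - h s))\<^sup>2 \<le> (t - s) *
    ((LINT r:{0..t}|lborel. (norm (g r))\<^sup>2) - (LINT r:{0..s}|lborel. (norm (g r))\<^sup>2))"
proof -
  have split: "(LINT r:{0..t}|lborel. f r) = (LINT r:{0..s}|lborel. f r) + (LINT r:{s<..t}|lborel. f r)"
    if "set_integrable lborel {0..1} f" for f :: "real \<Rightarrow> 'c::{second_countable_topology, banach}"
  proof -
    have eq: "{0..t} = {0..s} \<union> {s<..t}" using st by auto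
    show ?thesis unfolding eq
      by (rule set_integral_Un) (use st in \<open>auto intro!: set_integrable_subset[OF that]\<close>)
  qed
  have "h t - h s = (LINT r:{s<..t}|lborel. g r)"
    using split[of g] g st by (simp add: cm_deriv_def)
  moreover have "(LINT r:{0..t}|lborel. (norm (g r))\<^sup>2) - (LINT r:{0..s}|lborel. (norm (g r))\<^sup>2)
      = (LINT r:{s<..t}|lborel. (norm (g r))\<^sup>2)"
    using split[of "\<lambda>r. (norm (g r))\<^sup>2"] g by (simp add: cm_deriv_def)
  ultimately show ?thesis
    by (simp only:) (intro norm_set_integral_sq_le st(2) cm_deriv_integrable[OF g]; use st in auto)
qed

lemma cm_norm_sq_nonneg: "cm_norm_sq h \<ge> 0"
  unfolding cm_norm_sq_def set_lebesgue_integral_def by (rule Bochner_Integration.integral_nonneg) auto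

text \<open>
  Cauchy--Schwarz on every cell of the uniform grid; the integrals of \<open>|g|\<^sup>2\<close> over the cells telescope.
\<close>
lemma sum_cm_increments_sq_le:
  assumes g: "cm_deriv h g" and n: "n \<le> N"
  shows "(\<Sum>k<n. (norm (h (real (Suc k) / real N) - h (real k / real N)))\<^sup>2) \<le> cm_norm_sq h / real N"
proof (cases "N = 0")
  case False
  let ?Q = "\<lambda>t. LINT r:{0..t}|lborel. (norm (g r))\<^sup>2"
  have le: "real (Suc k) / real N \<le> 1" if "k < n" for k using that n False by (simp add: field_simps)
  have "(\<Sum>k<n. (norm (h (real (Suc k) / real N) - h (real k / real N)))\<^sup>2)
      \<le> (\<Sum>k<n. (real (Suc k) / real N - real k / real N) * (?Q (real (Suc k) / real N) - ?Q (real k / real N)))"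
    using False le by (intro sum_mono cm_increment_sq_le[OF g]) (auto simp: divide_strict_right_mono)
  also have "\<dots> = (1 / real N) * (\<Sum>k<n. ?Q (real (Suc k) / real N) - ?Q (real k / real N))"
    unfolding sum_distrib_left by (intro sum.cong) (auto simp: diff_divide_distrib[symmetric])
  also have "(\<Sum>k<n. ?Q (real (Suc k) / real N) - ?Q (real k / real N)) = ?Q (real n / real N) - ?Q 0"
    using sum_lessThan_telescope[of "\<lambda>k. ?Q (real k / real N)" n] by simp
  also have "\<dots> \<le> ?Q 1"
  proof -
    have sub: "{0..real n / real N} \<subseteq> {0..1}" using n False by auto
    have "?Q (real n / real N) \<le> ?Q 1" unfolding set_lebesgue_integral_def
      using sub cm_deriv_integrable(2)[OF g, of "{0..real n / real N}"] cm_deriv_integrable(2)[OF g, of "{0..1}"]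
      by (intro integral_mono) (auto simp: set_integrable_def indicator_def)
    moreover have "?Q 0 \<ge> 0" unfolding set_lebesgue_integral_def by (rule Bochner_Integration.integral_nonneg) auto
    ultimately show ?thesis by simp
  qed
  also have "?Q 1 = cm_norm_sq h" by (rule cm_norm_sq_eq[OF g, symmetric])
  finally show ?thesis by (simp add: divide_right_mono mult_left_mono)
qed (use n in simp)

section \<open>Time integrals of processes known from the past\<close>

text \<open>
  Only measurability of \<open>v\<close> in both variables and \<open>F\<close>-measurability at almost every single time are given, so
  Fubini's theorem does not yield \<open>F\<close>-measurability of the integral \<open>Y\<close> directly. Let \<open>Z = Y - E[Y|F]\<close>, which is
  orthogonal to all bounded \<open>F\<close>-measurable variables. It is orthogonal to almost every \<open>v s\<close>, hence by Fubini's
  theorem to \<open>Y\<close>, and to \<open>E[Y|F]\<close>. So \<open>E[Z\<^sup>2] = 0\<close> and \<open>Y = E[Y|F]\<close> almost surely.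
\<close>
lemma (in prob_space) integral_of_bounded_past_measurable:
  fixes v :: "real \<times> 'a \<Rightarrow> real"
  assumes F: "subalgebra M F"
    and v[measurable]: "v \<in> borel_measurable (lborel \<Otimes>\<^sub>M M)"
    and K: "\<And>z. \<bar>v z\<bar> \<le> K"
    and S[measurable]: "S \<in> sets borel" and S_fin: "emeasure lborel S < \<infinity>"
    and past: "AE s in lborel. s \<in> S \<longrightarrow> (\<lambda>w. v (s, w)) \<in> borel_measurable F"
  shows "\<exists>Y\<in>borel_measurable F. AE w in M. (LINT s:S|lborel. v (s, w)) = Y w"
proof -
  interpret finite_measure_subalgebra M F by unfold_locales (fact F)
  interpret sigma_finite_subalgebra M F by (rule finite_measure_subalgebra_is_sigma_finite) unfold_locales
  interpret P: pair_sigma_finite lborel M ..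
  have K0: "K \<ge> 0" using K[of undefined] by simp
  define Y where "Y w = (LINT s:S|lborel. v (s, w))" for w
  define C where "C = K * measure lborel S"
  define E where "E = real_cond_exp M F Y"
  define Z where "Z w = Y w - E w" for w
  have S_int: "integrable lborel (indicator S :: real \<Rightarrow> real)"
    using S_fin by (simp add: integrable_indicator_iff)
  have Y_meas[measurable]: "Y \<in> borel_measurable M"
    unfolding Y_def set_lebesgue_integral_def by measurable
  have Y_bound: "\<bar>Y w\<bar> \<le> C" if "w \<in> space M" for w
  proof -
    have "norm (Y w) \<le> (\<integral>s. norm (indicator S s *\<^sub>R v (s, w)) \<partial>lborel)"
      unfolding Y_def set_lebesgue_integral_def by (rule integral_norm_bound)
    also have "\<dots> \<le> (\<integral>s. K * indicator S s \<partial>lborel)"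
    proof (rule integral_mono')
      show "integrable lborel (\<lambda>s. K * indicator S s)" using S_int by simp
    qed (use K K0 in \<open>auto simp: indicator_def\<close>)
    also have "\<dots> = C" using S_fin by (simp add: C_def)
    finally show ?thesis by simp
  qed
  have Y_int: "integrable M Y" by (rule integrable_const_bound[of _ C]) (use Y_bound in auto)
  have E_meas[measurable]: "E \<in> borel_measurable F" "E \<in> borel_measurable M"
    unfolding E_def by (auto intro: borel_measurable_cond_exp borel_measurable_cond_exp2)
  have "AE w in M. E w \<ge> - C" "AE w in M. E w \<le> C" unfolding E_def
    using Y_bound by (auto intro!: real_cond_exp_ge_c real_cond_exp_le_c Y_int simp: abs_le_iff minus_le_iff)
  then have E_bound: "AE w in M. \<bar>E w\<bar> \<le> C" by eventually_elim auto
  have Y_bound_AE: "AE w in M. \<bar>Y w\<bar> \<le> C" using Y_bound by auto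
  have orth: "expectation (\<lambda>w. h w * Z w) = 0"
    if [measurable]: "h \<in> borel_measurable F" and h: "AE w in M. \<bar>h w\<bar> \<le> L" for h L
  proof -
    have [measurable]: "h \<in> borel_measurable M" by (rule measurable_from_subalg[OF F]) fact
    have hY: "integrable M (\<lambda>w. h w * Y w)"
    proof (rule integrable_const_bound[of _ "L * C"])
      show "AE w in M. norm (h w * Y w) \<le> L * C"
        using h Y_bound_AE by eventually_elim (auto simp: abs_mult intro!: mult_mono)
    qed measurable
    note cond = real_cond_exp_intg[OF hY, folded E_def]
    show ?thesis unfolding Z_def right_diff_distrib
      using hY cond by (subst Bochner_Integration.integral_diff) auto
  qed
  have ZE: "expectation (\<lambda>w. E w * Z w) = 0" by (rule orth[OF _ E_bound]) simp
  have ZY: "expectation (\<lambda>w. Y w * Z w) = 0"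
  proof -
    let ?f = "\<lambda>s w. indicator S s * v (s, w) * Z w"
    have Z_bound: "AE w in M. \<bar>Z w\<bar> \<le> 2 * C"
      using E_bound Y_bound_AE by eventually_elim (auto simp: Z_def)
    have Z_meas[measurable]: "Z \<in> borel_measurable M" unfolding Z_def by measurable
    have "expectation (\<lambda>w. Y w * Z w) = (\<integral>w. (\<integral>s. ?f s w \<partial>lborel) \<partial>M)"
      by (simp add: Y_def set_lebesgue_integral_def)
    also have "\<dots> = (\<integral>s. (\<integral>w. ?f s w \<partial>M) \<partial>lborel)"
    proof (rule P.Fubini_integral, rule P.Fubini_integrable)
      show "case_prod ?f \<in> borel_measurable (lborel \<Otimes>\<^sub>M M)"
        by measurable
      have fi: "integrable M (?f s)" and fb: "(\<integral>w. norm (?f s w) \<partial>M) \<le> indicator S s * (K * (2 * C))" for s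
      proof -
        have b: "AE w in M. \<bar>?f s w\<bar> \<le> indicator S s * (K * (2 * C))"
          using Z_bound
        proof eventually_elim
          fix w assume "\<bar>Z w\<bar> \<le> 2 * C"
          then have "\<bar>v (s, w) * Z w\<bar> \<le> K * (2 * C)" using K[of "(s, w)"] unfolding abs_mult by (intro mult_mono) auto
          then show "\<bar>?f s w\<bar> \<le> indicator S s * (K * (2 * C))" by (auto simp: indicator_def)
        qed
        show fi: "integrable M (?f s)"
          by (rule integrable_const_bound[OF b[folded real_norm_def]]) measurable
        have "(\<integral>w. norm (?f s w) \<partial>M) \<le> (\<integral>w. indicator S s * (K * (2 * C)) \<partial>M)"
          using fi b by (intro integral_mono_AE) auto
        then show "(\<integral>w. norm (?f s w) \<partial>M) \<le> indicator S s * (K * (2 * C))" by (simp add: prob_space)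
      qed
      show "integrable lborel (\<lambda>s. \<integral>w. norm (case_prod ?f (s, w)) \<partial>M)"
      proof (rule Bochner_Integration.integrable_bound)
        show "integrable lborel (\<lambda>s. indicator S s * (K * (2 * C)))" using S_int by simp
        show "AE s in lborel. norm (\<integral>w. norm (case_prod ?f (s, w)) \<partial>M) \<le> norm (indicator S s * (K * (2 * C)) :: real)"
          using fb by (intro AE_I2) (simp add: abs_of_nonneg order_trans[OF _ abs_ge_self])
        show "(\<lambda>s. \<integral>w. norm (case_prod ?f (s, w)) \<partial>M) \<in> borel_measurable lborel"
          by measurable
      qed
      show "AE s in lborel. integrable M (\<lambda>w. case_prod ?f (s, w))" using fi by simp
    qed
    also have "\<dots> = 0"
    proof (rule integral_eq_zero_AE)
      show "AE s in lborel. (\<integral>w. ?f s w \<partial>M) = 0" using past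
      proof eventually_elim
        fix s assume s: "s \<in> S \<longrightarrow> (\<lambda>w. v (s, w)) \<in> borel_measurable F"
        show "(\<integral>w. ?f s w \<partial>M) = 0"
        proof (cases "s \<in> S")
          case True
          then show ?thesis using s orth[of "\<lambda>w. v (s, w)" K] K by simp
        qed simp
      qed
    qed
    finally show ?thesis .
  qed
  have Z_meas[measurable]: "Z \<in> borel_measurable M" unfolding Z_def by measurable
  have Z_bound: "AE w in M. \<bar>Z w\<bar> \<le> 2 * C"
    using E_bound Y_bound_AE by eventually_elim (auto simp: Z_def)
  have "AE w in M. \<bar>Y w * Z w\<bar> \<le> C * (2 * C)" "AE w in M. \<bar>E w * Z w\<bar> \<le> C * (2 * C)"
    using E_bound Y_bound_AE Z_bound by (eventually_elim, auto simp: abs_mult intro!: mult_mono)+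
  then have YZ_int: "integrable M (\<lambda>w. Y w * Z w)" "integrable M (\<lambda>w. E w * Z w)"
    by (auto intro!: integrable_const_bound[of _ "C * (2 * C)"])
  have "expectation (\<lambda>w. Z w * Z w) = 0"
  proof -
    have "(\<lambda>w. Z w * Z w) = (\<lambda>w. Y w * Z w - E w * Z w)" by (auto simp: Z_def left_diff_distrib)
    then show ?thesis using YZ_int ZE ZY by simp
  qed
  moreover have "integrable M (\<lambda>w. Z w * Z w)"
    using Bochner_Integration.integrable_diff[OF YZ_int] by (simp add: Z_def left_diff_distrib)
  ultimately have "AE w in M. Z w * Z w = 0" by (subst (asm) integral_nonneg_eq_0_iff_AE) auto
  then have "AE w in M. (LINT s:S|lborel. v (s, w)) = E w" by eventually_elim (auto simp: Z_def Y_def)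
  then show ?thesis using E_meas(1) by blast
qed

text \<open>
  The bounded case, applied to truncations of the components.
\<close>
lemma (in prob_space) integral_of_past_measurable:
  fixes v :: "real \<times> 'a \<Rightarrow> 'b::euclidean_space"
  assumes F: "subalgebra M F"
    and v[measurable]: "v \<in> borel_measurable (lborel \<Otimes>\<^sub>M M)"
    and S: "S \<in> sets borel" and S_fin: "emeasure lborel S < \<infinity>"
    and int: "\<And>w. w \<in> space M \<Longrightarrow> set_integrable lborel S (\<lambda>s. v (s, w))"
    and past: "AE s in lborel. s \<in> S \<longrightarrow> (\<lambda>w. v (s, w)) \<in> borel_measurable F"
  shows "\<exists>Y\<in>borel_measurable F. AE w in M. (LINT s:S|lborel. v (s, w)) = Y w"
proof -
  define clamp :: "nat \<Rightarrow> real \<Rightarrow> real" where "clamp n x = max (- real n) (min (real n) x)" for n x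
  have clamp_meas[measurable]: "clamp n \<in> borel_measurable borel" for n unfolding clamp_def by measurable
  have "\<exists>Y\<in>borel_measurable F. AE w in M. (LINT s:S|lborel. v (s, w) \<bullet> b) = Y w" for b
  proof -
    have "\<exists>Y\<in>borel_measurable F. AE w in M. (LINT s:S|lborel. clamp n (v (s, w) \<bullet> b)) = Y w" for n
    proof (rule integral_of_bounded_past_measurable[OF F _ _ S S_fin, of _ "real n"])
      show "(\<lambda>z. clamp n (v z \<bullet> b)) \<in> borel_measurable (lborel \<Otimes>\<^sub>M M)"
        by measurable
      show "AE s in lborel. s \<in> S \<longrightarrow> (\<lambda>w. clamp n (v (s, w) \<bullet> b)) \<in> borel_measurable F"
        using past
      proof eventually_elim
        case (elim s)
        show ?case
        proof
          assume "s \<in> S"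
          with elim have [measurable]: "(\<lambda>w. v (s, w)) \<in> borel_measurable F" by simp
          show "(\<lambda>w. clamp n (v (s, w) \<bullet> b)) \<in> borel_measurable F" by measurable
        qed
      qed
    qed (auto simp: clamp_def)
    then have "\<exists>Y. \<forall>n. Y n \<in> borel_measurable F \<and> (AE w in M. (LINT s:S|lborel. clamp n (v (s, w) \<bullet> b)) = Y n w)"
      by (intro choice) blast
    then obtain Y where Y: "\<And>n. Y n \<in> borel_measurable F"
      "\<And>n. AE w in M. (LINT s:S|lborel. clamp n (v (s, w) \<bullet> b)) = Y n w" by blast
    have conv: "(\<lambda>n. LINT s:S|lborel. clamp n (v (s, w) \<bullet> b)) \<longlonglongrightarrow> (LINT s:S|lborel. v (s, w) \<bullet> b)"
      if w: "w \<in> space M" for w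
      unfolding set_lebesgue_integral_def
    proof (rule integral_dominated_convergence)
      have [measurable]: "(\<lambda>s. v (s, w)) \<in> borel_measurable lborel"
        using w by measurable
      have vb: "set_integrable lborel S (\<lambda>s. v (s, w) \<bullet> b)"
        using int[OF w] unfolding set_integrable_def by (simp flip: inner_scaleR_left)
      show "integrable lborel (\<lambda>s. norm (indicator S s *\<^sub>R (v (s, w) \<bullet> b)))"
        using vb unfolding set_integrable_def by (rule integrable_norm)
      show "(\<lambda>s. indicat_real S s *\<^sub>R (v (s, w) \<bullet> b)) \<in> borel_measurable lborel"
        "\<And>n. (\<lambda>s. indicat_real S s *\<^sub>R clamp n (v (s, w) \<bullet> b)) \<in> borel_measurable lborel"
        using S by measurable
      show "AE s in lborel. norm (indicat_real S s *\<^sub>R clamp n (v (s, w) \<bullet> b)) \<le> norm (indicat_real S s *\<^sub>R (v (s, w) \<bullet> b))" for n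
        by (intro AE_I2) (auto simp: clamp_def indicator_def)
      show "AE s in lborel. (\<lambda>n. indicat_real S s *\<^sub>R clamp n (v (s, w) \<bullet> b)) \<longlonglongrightarrow> indicat_real S s *\<^sub>R (v (s, w) \<bullet> b)"
      proof (intro AE_I2 tendsto_intros)
        fix s
        obtain N where N: "\<bar>v (s, w) \<bullet> b\<bar> \<le> real N" using real_arch_simple by blast
        then have "\<forall>\<^sub>F n in sequentially. clamp n (v (s, w) \<bullet> b) = v (s, w) \<bullet> b"
          unfolding eventually_sequentially clamp_def by (intro exI[of _ N]) auto
        then show "(\<lambda>n. clamp n (v (s, w) \<bullet> b)) \<longlonglongrightarrow> v (s, w) \<bullet> b" by (rule tendsto_eventually)
      qed
    qed
    have "AE w in M. \<forall>n. (LINT s:S|lborel. clamp n (v (s, w) \<bullet> b)) = Y n w" using Y(2) by (subst AE_all_countable) auto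
    then have "AE w in M. (LINT s:S|lborel. v (s, w) \<bullet> b) = lim (\<lambda>n. Y n w)"
    proof (rule AE_mp, intro AE_I2 impI)
      fix w assume "w \<in> space M" "\<forall>n. (LINT s:S|lborel. clamp n (v (s, w) \<bullet> b)) = Y n w"
      then show "(LINT s:S|lborel. v (s, w) \<bullet> b) = lim (\<lambda>n. Y n w)"
        using conv[of w] by (simp add: limI)
    qed
    moreover have "(\<lambda>w. lim (\<lambda>n. Y n w)) \<in> borel_measurable F"
      using Y(1) by (intro borel_measurable_lim_metric) auto
    ultimately show ?thesis by (intro bexI[of _ "\<lambda>w. lim (\<lambda>n. Y n w)"])
  qed
  then have "\<exists>Y. \<forall>b. Y b \<in> borel_measurable F \<and> (AE w in M. (LINT s:S|lborel. v (s, w) \<bullet> b) = Y b w)"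
    by (intro choice) blast
  then obtain Y where Y: "\<And>b. Y b \<in> borel_measurable F"
    "\<And>b. AE w in M. (LINT s:S|lborel. v (s, w) \<bullet> b) = Y b w" by blast
  have "AE w in M. \<forall>b\<in>Basis. (LINT s:S|lborel. v (s, w) \<bullet> b) = Y b w"
    using Y(2) by (subst AE_ball_countable) (auto intro: countable_finite)
  then have "AE w in M. (LINT s:S|lborel. v (s, w)) = (\<Sum>b\<in>Basis. Y b w *\<^sub>R b)"
  proof (rule AE_mp, intro AE_I2 impI)
    fix w assume w: "w \<in> space M" and eq: "\<forall>b\<in>Basis. (LINT s:S|lborel. v (s, w) \<bullet> b) = Y b w"
    have "(LINT s:S|lborel. v (s, w)) \<bullet> b = Y b w" if "b \<in> Basis" for b
      using eq that int[OF w] unfolding set_lebesgue_integral_def set_integrable_def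
      by (simp flip: inner_scaleR_left integral_inner_left)
    then show "(LINT s:S|lborel. v (s, w)) = (\<Sum>b\<in>Basis. Y b w *\<^sub>R b)"
      by (subst euclidean_representation[symmetric]) simp
  qed
  moreover have "(\<lambda>w. \<Sum>b\<in>Basis. Y b w *\<^sub>R b) \<in> borel_measurable F" using Y(1) by measurable
  ultimately show ?thesis by (intro bexI[of _ "\<lambda>w. \<Sum>b\<in>Basis. Y b w *\<^sub>R b"])
qed

section \<open>The inequality for continuous cylinder functionals\<close>

text \<open>
  Wiener space together with a fixed adapted drift of finite energy.
\<close>
locale adapted_shift = wiener_measure \<mu> for \<mu> :: "(real \<Rightarrow> real ^ 'd::finite) measure" +
  fixes u :: "(real \<Rightarrow> real ^ 'd) \<Rightarrow> real \<Rightarrow> real ^ 'd"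
  assumes u: "u \<in> L2_adapted \<mu>"
begin

sublocale completion: prob_space "completion \<mu>" by (rule prob_space_wiener_completion)

lemma coordinate_measurable_completion: "t \<in> {0..1} \<Longrightarrow> (\<lambda>w. w t) \<in> borel_measurable (completion \<mu>)"
  by (rule measurable_completion) (rule coordinate_measurable)

lemma coordinate_measurable_filtration:
  assumes "s \<in> {0..t}" shows "(\<lambda>w. w s) \<in> borel_measurable (completed_filtration \<mu> t)"
proof (rule measurableI)
  fix A :: "(real ^ 'd) set" assume "A \<in> sets borel"
  then have "{w \<in> space \<mu>. w s \<in> A} \<in> sets (completed_filtration \<mu> t)"
    unfolding sets_completed_filtration using assms by (intro sigma_sets.Basic) blast
  then show "(\<lambda>w. w s) -` A \<inter> space (completed_filtration \<mu> t) \<in> sets (completed_filtration \<mu> t)"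
    by (simp add: space_completed_filtration vimage_def Int_def conj_commute)
qed simp

text \<open>
  A jointly measurable derivative whose time ranges over the whole real line.
\<close>
lemma ex_derivative:
  obtains V where "V \<in> borel_measurable (lborel \<Otimes>\<^sub>M completion \<mu>)"
    and "\<And>w. w \<in> space \<mu> \<Longrightarrow> cm_deriv (u w) (\<lambda>s. V (s, w))"
    and "AE s in lborel. s \<in> {0..1} \<longrightarrow> (\<lambda>w. V (s, w)) \<in> borel_measurable (completed_filtration \<mu> s)"
proof -
  obtain v where v: "(\<lambda>(s, w). v s w) \<in> borel_measurable (restrict_space lborel {0..1} \<Otimes>\<^sub>M completion \<mu>)"
    and d: "\<And>w. w \<in> space \<mu> \<Longrightarrow> cm_deriv (u w) (\<lambda>s. v s w)"
    and a: "AE s in lborel. s \<in> {0..1} \<longrightarrow> v s \<in> borel_measurable (completed_filtration \<mu> s)"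
    using u unfolding L2_adapted_def by auto
  \<comment> \<open>clamping the time makes the version jointly measurable on the whole line\<close>
  define c where "c s = max 0 (min 1 s)" for s :: real
  have c: "c \<in> measurable lborel (restrict_space lborel {0..1})"
    unfolding c_def by (rule measurable_restrict_space2) (auto simp: lborel_def)
  define V where "V z = v (c (fst z)) (snd z)" for z
  have eq: "V (s, w) = v s w" if "s \<in> {0..1}" for s w using that by (simp add: V_def c_def)
  show thesis
  proof
    have "(\<lambda>z. (c (fst z), snd z)) \<in> measurable (lborel \<Otimes>\<^sub>M completion \<mu>) (restrict_space lborel {0..1} \<Otimes>\<^sub>M completion \<mu>)"
      using c by measurable
    from measurable_compose[OF this v] show "V \<in> borel_measurable (lborel \<Otimes>\<^sub>M completion \<mu>)"
      by (simp add: V_def[abs_def])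
    show "AE s in lborel. s \<in> {0..1} \<longrightarrow> (\<lambda>w. V (s, w)) \<in> borel_measurable (completed_filtration \<mu> s)"
      using a by eventually_elim (simp add: eq)
    fix w assume "w \<in> space \<mu>"
    from d[OF this] show "cm_deriv (u w) (\<lambda>s. V (s, w))"
      by (rule cm_deriv_cong) (simp add: eq)
  qed
qed

lemma cm_deriv_u: "w \<in> space \<mu> \<Longrightarrow> \<exists>g. cm_deriv (u w) g"
  using u unfolding L2_adapted_def by auto

lemma u_measurable:
  assumes t: "t \<in> {0..1}" shows "(\<lambda>w. u w t) \<in> borel_measurable (completion \<mu>)"
proof -
  obtain V where V[measurable]: "V \<in> borel_measurable (lborel \<Otimes>\<^sub>M completion \<mu>)"
    and d: "\<And>w. w \<in> space \<mu> \<Longrightarrow> cm_deriv (u w) (\<lambda>s. V (s, w))" by (rule ex_derivative) blast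
  have "(\<lambda>w. \<integral>s. indicator {0..t} s *\<^sub>R V (s, w) \<partial>lborel) \<in> borel_measurable (completion \<mu>)"
    by measurable
  then show ?thesis
    by (rule measurable_cong[THEN iffD1, rotated])
       (use d t in \<open>auto simp: cm_deriv_def set_lebesgue_integral_def\<close>)
qed

text \<open>
  The completed past at time \<open>t\<close> contains the pasts at all earlier times, so the derivative at almost every
  time before \<open>t\<close> is measurable with respect to it.
\<close>
lemma u_adapted:
  assumes t: "t \<in> {0..1}"
  shows "\<exists>Y\<in>borel_measurable (completed_filtration \<mu> t). AE w in completion \<mu>. u w t = Y w"
proof -
  obtain V where V[measurable]: "V \<in> borel_measurable (lborel \<Otimes>\<^sub>M completion \<mu>)"
    and d: "\<And>w. w \<in> space \<mu> \<Longrightarrow> cm_deriv (u w) (\<lambda>s. V (s, w))"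
    and a: "AE s in lborel. s \<in> {0..1} \<longrightarrow> (\<lambda>w. V (s, w)) \<in> borel_measurable (completed_filtration \<mu> s)"
    by (rule ex_derivative) blast
  have "\<exists>Y\<in>borel_measurable (completed_filtration \<mu> t). AE w in completion \<mu>. (LINT s:{0..t}|lborel. V (s, w)) = Y w"
  proof (rule completion.integral_of_past_measurable[OF subalgebra_completed_filtration V])
    show "AE s in lborel. s \<in> {0..t} \<longrightarrow> (\<lambda>w. V (s, w)) \<in> borel_measurable (completed_filtration \<mu> t)"
      using a
    proof eventually_elim
      case (elim s)
      show ?case
      proof
        assume s: "s \<in> {0..t}"
        show "(\<lambda>w. V (s, w)) \<in> borel_measurable (completed_filtration \<mu> t)"
        proof (rule measurable_from_subalg)
          show "subalgebra (completed_filtration \<mu> t) (completed_filtration \<mu> s)"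
            unfolding subalgebra_def using s completed_filtration_mono[of s t]
            by (simp add: space_completed_filtration)
          show "(\<lambda>w. V (s, w)) \<in> borel_measurable (completed_filtration \<mu> s)" using elim s t by auto
        qed
      qed
    qed
    show "set_integrable lborel {0..t} (\<lambda>s. V (s, w))" if "w \<in> space (completion \<mu>)" for w
      using d[of w] that t by (intro cm_deriv_integrable) auto
  qed (use t in auto)
  then obtain Y where Y: "Y \<in> borel_measurable (completed_filtration \<mu> t)"
    and ae: "AE w in completion \<mu>. (LINT s:{0..t}|lborel. V (s, w)) = Y w" by blast
  have "AE w in completion \<mu>. u w t = Y w"
    using ae AE_space by eventually_elim (use d t in \<open>auto simp: cm_deriv_def\<close>)
  then show ?thesis using Y by blast
qed

definition energy :: real where "energy = completion.expectation (\<lambda>w. cm_norm_sq (u w))"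

lemma cm_norm_sq_integrable: "integrable (completion \<mu>) (\<lambda>w. cm_norm_sq (u w))"
proof -
  obtain V where V[measurable]: "V \<in> borel_measurable (lborel \<Otimes>\<^sub>M completion \<mu>)"
    and d: "\<And>w. w \<in> space \<mu> \<Longrightarrow> cm_deriv (u w) (\<lambda>s. V (s, w))" by (rule ex_derivative) blast
  have "(\<lambda>w. \<integral>s. indicator {0..1} s *\<^sub>R (norm (V (s, w)))\<^sup>2 \<partial>lborel) \<in> borel_measurable (completion \<mu>)"
    by measurable
  then have "(\<lambda>w. cm_norm_sq (u w)) \<in> borel_measurable (completion \<mu>)"
    by (rule measurable_cong[THEN iffD1, rotated])
       (use cm_norm_sq_eq[OF d] in \<open>auto simp: set_lebesgue_integral_def\<close>)
  moreover have "(\<integral>\<^sup>+w. ennreal (cm_norm_sq (u w)) \<partial>completion \<mu>) < \<infinity>"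
    using u unfolding L2_adapted_def by blast
  ultimately show ?thesis by (intro integrableI_nonneg) (auto simp: cm_norm_sq_nonneg)
qed

lemma u_continuous: "w \<in> space \<mu> \<Longrightarrow> continuous_on {0..1} (u w)" and u_zero: "w \<in> space \<mu> \<Longrightarrow> u w 0 = 0"
  using cm_deriv_u cm_deriv_continuous cm_deriv_zero by blast+

lemma perturb_measurable: "perturb u \<in> measurable (completion \<mu>) \<mu>"
proof (rule measurable_into_wiener)
  fix w assume "w \<in> space (completion \<mu>)"
  then have w: "w \<in> space \<mu>" by simp
  have "continuous_on {0..1} (\<lambda>t. w t + u w t)"
    using w u_continuous by (intro continuous_intros) (auto simp: space_wiener)
  then have "continuous_on {0..1} (perturb u w)"
    by (rule continuous_on_eq) (simp add: perturb_def)
  then show "perturb u w \<in> space \<mu>" using w by (auto simp: perturb_def space_wiener u_zero)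
next
  fix t :: real assume "t \<in> {0..1}"
  then show "(\<lambda>w. perturb u w t) \<in> borel_measurable (completion \<mu>)"
    using u_measurable coordinate_measurable_completion by (simp add: perturb_def)
qed

lemma delayed_time: "t \<in> {0..1} \<Longrightarrow> max 0 (t - 1 / 2 ^ m) \<in> {0..1::real}"
proof -
  have "0 \<le> 1 / (2::real) ^ m" by simp
  then show "t \<in> {0..1} \<Longrightarrow> max 0 (t - 1 / 2 ^ m) \<in> {0..1::real}" unfolding atLeastAtMost_iff by linarith
qed

text \<open>
  The path shifted by the drift with a delay of one grid cell. Before time zero the drift is zero, which is
  why times are cut off there.
\<close>
definition grid_shift :: "nat \<Rightarrow> (real \<Rightarrow> real ^ 'd) \<Rightarrow> real \<Rightarrow> real ^ 'd" where
  "grid_shift m w = (\<lambda>t\<in>{0..1}. w t + u w (max 0 (t - 1 / 2 ^ m)))"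

text \<open>
  On the grid of mesh \<open>1 / N\<close> with \<open>N = 2^m\<close>, the steps \<open>\<xi> k\<close> of the path are Gaussian with variance \<open>1 / N\<close>. The
  step \<open>b k\<close> of the delayed drift is the increment of \<open>u\<close> over the preceding cell, so it is known at the time
  \<open>\<tau> k\<close> at which \<open>\<xi> k\<close> starts. The discrete inequality charges \<open>N / 2 * E[|b k|\<^sup>2]\<close> for it, and these costs sum up
  to at most half the energy.
\<close>
lemma grid_shift_inequality:
  assumes \<phi>: "cylinder_continuous n \<phi>" and m: "n \<le> m"
  shows "completion.expectation (\<lambda>w. \<phi> (grid_shift m w))
    \<le> ln (completion.expectation (\<lambda>w. exp (\<phi> w))) + energy / 2"
proof -
  define N :: nat where "N = 2 ^ m"
  have N: "N > 0" "real N = 2 ^ m" by (auto simp: N_def)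
  define \<tau> where "\<tau> k = real k / 2 ^ m" for k
  have \<tau>01: "\<tau> k \<in> {0..1}" if "k \<le> N" for k using that by (simp add: \<tau>_def N_def)
  have \<tau>_mono: "\<tau> j \<le> \<tau> k" if "j \<le> k" for j k using that by (simp add: \<tau>_def divide_right_mono)
  have \<tau>_Suc: "\<tau> (Suc k) - \<tau> k = 1 / real N" for k by (simp add: \<tau>_def N diff_divide_distrib[symmetric])
  have "\<exists>Y. \<forall>t. t \<in> {0..1} \<longrightarrow> Y t \<in> borel_measurable (completed_filtration \<mu> t) \<and> (AE w in completion \<mu>. u w t = Y t w)"
    using u_adapted by (intro choice) blast
  then obtain Y where Y: "\<And>t. t \<in> {0..1} \<Longrightarrow> Y t \<in> borel_measurable (completed_filtration \<mu> t)"
    and Y_eq: "\<And>t. t \<in> {0..1} \<Longrightarrow> AE w in completion \<mu>. u w t = Y t w" by blast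
  define F where "F k = completed_filtration \<mu> (min 1 (\<tau> k))" for k
  have F_eq: "F k = completed_filtration \<mu> (\<tau> k)" if "k \<le> N" for k
    using \<tau>01[OF that] by (simp add: F_def)
  have F_sub: "subalgebra (F k) (completed_filtration \<mu> (\<tau> j))" if "j \<le> k" "k \<le> N" for j k
    unfolding F_eq[OF that(2)] subalgebra_def
    using completed_filtration_mono[OF \<tau>_mono[OF that(1)]] by (simp add: space_completed_filtration)
  define \<xi> where "\<xi> k w = w (\<tau> (Suc k)) - w (\<tau> k)" for k and w :: "real \<Rightarrow> real ^ 'd"
  \<comment> \<open>\<open>b k\<close> is only almost surely equal to a variable measurable in the past; \<open>a k\<close> is such a variable\<close>
  define a where "a k w = (if k = 0 then 0 else Y (\<tau> k) w - Y (\<tau> (k - 1)) w)" for k w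
  define b where "b k w = (if k = 0 then 0 else u w (\<tau> k) - u w (\<tau> (k - 1)))" for k w
  have ab: "AE w in completion \<mu>. a k w = b k w" if "k \<le> N" for k
  proof -
    have "AE w in completion \<mu>. u w (\<tau> k) = Y (\<tau> k) w \<and> u w (\<tau> (k - 1)) = Y (\<tau> (k - 1)) w"
      using that Y_eq[OF \<tau>01[of k]] Y_eq[OF \<tau>01[of "k - 1"]] by auto
    then show ?thesis by eventually_elim (simp add: a_def b_def)
  qed
  have b_meas[measurable]: "b k \<in> borel_measurable (completion \<mu>)" if "k \<le> N" for k
    using that u_measurable[OF \<tau>01[of k]] u_measurable[OF \<tau>01[of "k - 1"]] by (cases "k = 0") (auto simp: b_def[abs_def])
  have sum_b: "(\<Sum>k<N. (norm (b k w))\<^sup>2) \<le> cm_norm_sq (u w) / real N" if w: "w \<in> space \<mu>" for w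
  proof -
    obtain g where g: "cm_deriv (u w) g" using cm_deriv_u[OF w] by blast
    obtain N' where N': "N = Suc N'" using N by (cases N) auto
    have "(\<Sum>k<N. (norm (b k w))\<^sup>2) = (\<Sum>k<N'. (norm (u w (\<tau> (Suc k)) - u w (\<tau> k)))\<^sup>2)"
      unfolding N' by (subst sum.lessThan_Suc_shift) (simp add: b_def)
    also have "\<dots> \<le> cm_norm_sq (u w) / real N"
      using sum_cm_increments_sq_le[OF g, of N' N] N' unfolding \<tau>_def N(2)[symmetric] by simp
    finally show ?thesis .
  qed
  have b_int: "integrable (completion \<mu>) (\<lambda>w. (norm (b k w))\<^sup>2)" if k: "k < N" for k
  proof (rule Bochner_Integration.integrable_bound)
    show "integrable (completion \<mu>) (\<lambda>w. cm_norm_sq (u w) / real N)" using cm_norm_sq_integrable by simp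
    have "(norm (b k w))\<^sup>2 \<le> cm_norm_sq (u w) / real N" if "w \<in> space \<mu>" for w
      using sum_b[OF that] member_le_sum[of k "{..<N}" "\<lambda>k. (norm (b k w))\<^sup>2"] k by auto
    then show "AE w in completion \<mu>. norm ((norm (b k w))\<^sup>2) \<le> norm (cm_norm_sq (u w) / real N)"
      by (intro AE_I2) (simp add: cm_norm_sq_nonneg)
    show "(\<lambda>w. (norm (b k w))\<^sup>2) \<in> borel_measurable (completion \<mu>)" using b_meas[of k] k by simp
  qed
  have Y_meas: "Y (\<tau> j) \<in> borel_measurable (F k)" if "j \<le> k" "k \<le> N" for j k
    by (rule measurable_from_subalg[OF F_sub[OF that] Y[OF \<tau>01]]) (use that in simp)
  have a_meas: "a k \<in> borel_measurable (F k)" if "k \<le> N" for k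
    using Y_meas[of k k] Y_meas[of "k - 1" k] that by (cases "k = 0") (simp_all add: a_def[abs_def])
  have F_alg: "subalgebra (completion \<mu>) (F k)" for k
    unfolding F_def by (rule subalgebra_completed_filtration) simp
  have a_meas': "a k \<in> borel_measurable (completion \<mu>)" if "k \<le> N" for k
    by (rule measurable_from_subalg[OF F_alg a_meas[OF that]])
  have a_int: "integrable (completion \<mu>) (\<lambda>w. (norm (a k w))\<^sup>2)"
    and a_exp: "completion.expectation (\<lambda>w. (norm (a k w))\<^sup>2) = completion.expectation (\<lambda>w. (norm (b k w))\<^sup>2)"
    if k: "k < N" for k
  proof -
    have [measurable]: "a k \<in> borel_measurable (completion \<mu>)" "b k \<in> borel_measurable (completion \<mu>)"
      using b_meas[of k] a_meas'[of k] k by simp_all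
    have ae: "AE w in completion \<mu>. (norm (a k w))\<^sup>2 = (norm (b k w))\<^sup>2"
      using ab[of k] k by (auto elim!: eventually_mono)
    show "integrable (completion \<mu>) (\<lambda>w. (norm (a k w))\<^sup>2)"
      by (subst integrable_cong_AE[OF _ _ ae]) (use b_int[OF k] in auto)
    show "completion.expectation (\<lambda>w. (norm (a k w))\<^sup>2) = completion.expectation (\<lambda>w. (norm (b k w))\<^sup>2)"
      by (rule integral_cong_AE[OF _ _ ae]) auto
  qed
  \<comment> \<open>the step path with given increments; the functional sees it only on the grid\<close>
  define path where "path x = (\<lambda>t\<in>{0..1::real}. \<Sum>i<nat \<lfloor>t * 2 ^ m\<rfloor>. x i)" for x :: "nat \<Rightarrow> real ^ 'd"
  have path_meas: "path \<in> measurable (Pi\<^sub>M {..<N} (\<lambda>_. borel)) (\<Pi>\<^sub>M t\<in>{0..1}. borel)"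
    unfolding path_def[abs_def]
  proof (rule measurable_restrict)
    fix t :: real assume t: "t \<in> {0..1}"
    have "i \<in> {..<N}" if "i \<in> {..<nat \<lfloor>t * 2 ^ m\<rfloor>}" for i
    proof -
      have "real i < t * 2 ^ m" "t * 2 ^ m \<le> 2 ^ m"
        using that t by (auto simp: less_floor_iff zless_nat_eq_int_zless)
      then have "real i < real N" unfolding N by linarith
      then show ?thesis by simp
    qed
    then show "(\<lambda>x. \<Sum>i<nat \<lfloor>t * 2 ^ m\<rfloor>. x i) \<in> borel_measurable (Pi\<^sub>M {..<N} (\<lambda>_. borel :: (real ^ 'd) measure))"
      by (intro borel_measurable_sum measurable_component_singleton)
  qed
  have \<tau>_nm: "real k / 2 ^ n = \<tau> (k * 2 ^ (m - n))" for k
    using m by (simp add: \<tau>_def field_simps flip: power_add)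
  have path_grid: "path x (real k / 2 ^ n) = (\<Sum>i<k * 2 ^ (m - n). x i)" if "k \<le> 2 ^ n" for x k
  proof -
    have "real k / 2 ^ n * 2 ^ m = real (k * 2 ^ (m - n))" unfolding \<tau>_nm \<tau>_def by simp
    moreover have "real k / 2 ^ n \<in> {0..1}" using that by simp
    ultimately show ?thesis by (simp only: path_def restrict_apply if_True floor_of_nat nat_int)
  qed
  have kN: "k * 2 ^ (m - n) \<le> N" if "k \<le> 2 ^ n" for k
    using mult_right_mono[OF that, of "2 ^ (m - n)"] m by (simp add: N_def flip: power_add)
  obtain B where B: "\<And>w. \<bar>\<phi> w\<bar> \<le> B" using \<phi> unfolding cylinder_continuous_def by auto
  have \<phi>_meas: "\<phi> \<in> borel_measurable (\<Pi>\<^sub>M t\<in>{0..1}. borel)"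
    and \<phi>_grid: "\<And>w w'. (\<And>k. k \<le> 2 ^ n \<Longrightarrow> w (real k / 2 ^ n) = w' (real k / 2 ^ n)) \<Longrightarrow> \<phi> w = \<phi> w'"
    using \<phi> unfolding cylinder_continuous_def by blast+
  define G where "G x = \<phi> (path x)" for x
  have G_meas: "G \<in> borel_measurable (Pi\<^sub>M {..<N} (\<lambda>_. borel))"
    unfolding G_def[abs_def] using path_meas \<phi>_meas by (rule measurable_compose)
  have sum_\<xi>: "(\<Sum>i<K. \<xi> i w) = w (\<tau> K)" if "w \<in> space \<mu>" for K w
  proof -
    have "(\<Sum>i<K. \<xi> i w) = w (\<tau> K) - w (\<tau> 0)" unfolding \<xi>_def by (induction K) auto
    then show ?thesis using that by (simp add: \<tau>_def space_wiener)
  qed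
  have sum_b': "(\<Sum>i<K. b i w) = u w (max 0 (\<tau> K - 1 / 2 ^ m))" if "w \<in> space \<mu>" for K w
  proof (cases K)
    case 0
    then show ?thesis using u_zero[OF that] by (simp add: \<tau>_def)
  next
    case (Suc K')
    have "(\<Sum>i<Suc K'. b i w) = u w (\<tau> K') - u w (\<tau> 0)" by (induction K') (auto simp: b_def)
    moreover have "\<tau> (Suc K') - 1 / 2 ^ m = \<tau> K'" by (simp add: \<tau>_def field_simps)
    moreover have "0 \<le> \<tau> K'" by (simp add: \<tau>_def)
    ultimately show ?thesis using u_zero[OF that] Suc by (simp add: \<tau>_def)
  qed
  have G_\<xi>: "G (\<lambda>i\<in>{..<N}. \<xi> i w) = \<phi> w" if w: "w \<in> space \<mu>" for w
    unfolding G_def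
  proof (rule \<phi>_grid)
    fix k :: nat assume k: "k \<le> 2 ^ n"
    have "path (\<lambda>i\<in>{..<N}. \<xi> i w) (real k / 2 ^ n) = (\<Sum>i<k * 2 ^ (m - n). \<xi> i w)"
      unfolding path_grid[OF k] using kN[OF k] by (intro sum.cong) auto
    then show "path (\<lambda>i\<in>{..<N}. \<xi> i w) (real k / 2 ^ n) = w (real k / 2 ^ n)"
      by (simp only: sum_\<xi>[OF w] \<tau>_nm)
  qed
  have G_\<xi>b: "G (\<lambda>i\<in>{..<N}. \<xi> i w + b i w) = \<phi> (grid_shift m w)" if w: "w \<in> space \<mu>" for w
    unfolding G_def
  proof (rule \<phi>_grid)
    fix k :: nat assume k: "k \<le> 2 ^ n"
    have "path (\<lambda>i\<in>{..<N}. \<xi> i w + b i w) (real k / 2 ^ n) = (\<Sum>i<k * 2 ^ (m - n). \<xi> i w + b i w)"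
      unfolding path_grid[OF k] using kN[OF k] by (intro sum.cong) auto
    moreover have "\<tau> (k * 2 ^ (m - n)) \<in> {0..1}" using kN[OF k] by (rule \<tau>01)
    ultimately show "path (\<lambda>i\<in>{..<N}. \<xi> i w + b i w) (real k / 2 ^ n) = grid_shift m w (real k / 2 ^ n)"
      by (simp only: sum.distrib sum_\<xi>[OF w] sum_b'[OF w] \<tau>_nm grid_shift_def restrict_apply if_True)
  qed
  have main: "completion.expectation (\<lambda>w. G (\<lambda>i\<in>{..<N}. \<xi> i w + a i w))
    \<le> ln (completion.expectation (\<lambda>w. exp (G (\<lambda>i\<in>{..<N}. \<xi> i w))))
       + (\<Sum>k<N. completion.expectation (\<lambda>w. (norm (a k w))\<^sup>2) / (2 * (1 / real N)))"
  proof (rule completion.adapted_gaussian_shift_le[where F = F and B = B])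
    show "subalgebra (completion \<mu>) (F k)" for k by (rule F_alg)
    show "sets (F j) \<subseteq> sets (F k)" if "j \<le> k" "k < N" for j k
      unfolding F_def using \<tau>_mono[OF that(1)] by (intro completed_filtration_mono) auto
    show "a k \<in> borel_measurable (F k)" if "k < N" for k using a_meas that by simp
    show "\<xi> k \<in> borel_measurable (completion \<mu>)" if "k < N" for k
      unfolding \<xi>_def[abs_def] using that by (intro borel_measurable_diff coordinate_measurable_completion \<tau>01) auto
    show "\<xi> j \<in> borel_measurable (F k)" if "j < k" "k < N" for j k
    proof -
      have "\<tau> (Suc j) \<in> {0..\<tau> k}" "\<tau> j \<in> {0..\<tau> k}"
        using that \<tau>_mono[of "Suc j" k] \<tau>_mono[of j k] by (auto simp: \<tau>_def)
      then show ?thesis unfolding \<xi>_def[abs_def] F_eq[OF less_imp_le[OF that(2)]]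
        by (intro borel_measurable_diff coordinate_measurable_filtration)
    qed
    show "indep_of_past (completion \<mu>) (F k) (\<xi> k)" if "k < N" for k
      unfolding F_eq[OF less_imp_le[OF that]] \<xi>_def[abs_def] using that \<tau>01[of "Suc k"] \<tau>_mono[of k "Suc k"]
      unfolding \<tau>_def[of k] by (intro completed_filtration_indep) auto
    show "centred_gaussian (1 / real N) (distr (completion \<mu>) borel (\<xi> k))" if k: "k < N" for k
    proof -
      have "\<xi> k \<in> borel_measurable \<mu>" unfolding \<xi>_def[abs_def]
        using k by (intro borel_measurable_diff coordinate_measurable \<tau>01) auto
      then have "distr (completion \<mu>) borel (\<xi> k) = distr \<mu> borel (\<xi> k)" by (rule distr_completion)
      moreover have "0 < \<tau> (Suc k) - \<tau> k" unfolding \<tau>_Suc using N by simp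
      then have "centred_gaussian (\<tau> (Suc k) - \<tau> k) (distr \<mu> borel (\<xi> k))" unfolding \<xi>_def[abs_def]
        using k \<tau>01[of k] \<tau>01[of "Suc k"] by (intro increment_gaussian) auto
      ultimately show ?thesis unfolding \<tau>_Suc by simp
    qed
    show "G \<in> borel_measurable (Pi\<^sub>M {..<N} (\<lambda>_. borel))" by (rule G_meas)
    show "\<bar>G z\<bar> \<le> B" for z unfolding G_def by (rule B)
  qed (rule a_int)
  have "AE w in completion \<mu>. \<forall>k\<in>{..<N}. a k w = b k w"
    using ab by (subst AE_ball_countable) auto
  then have "AE w in completion \<mu>. G (\<lambda>i\<in>{..<N}. \<xi> i w + a i w) = \<phi> (grid_shift m w)"
    using AE_space
  proof eventually_elim
    case (elim w)
    then have "(\<lambda>i\<in>{..<N}. \<xi> i w + a i w) = (\<lambda>i\<in>{..<N}. \<xi> i w + b i w)" by (auto simp: restrict_def)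
    then show ?case using G_\<xi>b[of w] elim by simp
  qed
  moreover have "(\<lambda>w. G (\<lambda>i\<in>{..<N}. \<xi> i w + a i w)) \<in> borel_measurable (completion \<mu>)"
  proof (rule measurable_compose[OF _ G_meas], intro measurable_restrict borel_measurable_add)
    fix i assume i: "i \<in> {..<N}"
    show "\<xi> i \<in> borel_measurable (completion \<mu>)"
      unfolding \<xi>_def[abs_def] using i by (intro borel_measurable_diff coordinate_measurable_completion \<tau>01) auto
    show "a i \<in> borel_measurable (completion \<mu>)"
      using a_meas'[of i] i by simp
  qed
  moreover have grid_meas: "(\<lambda>w. \<phi> (grid_shift m w)) \<in> borel_measurable (completion \<mu>)"
  proof -
    have "(\<lambda>w. G (\<lambda>i\<in>{..<N}. \<xi> i w + b i w)) \<in> borel_measurable (completion \<mu>)"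
    proof (rule measurable_compose[OF _ G_meas], intro measurable_restrict borel_measurable_add)
      fix i assume i: "i \<in> {..<N}"
      show "\<xi> i \<in> borel_measurable (completion \<mu>)"
        unfolding \<xi>_def[abs_def] using i by (intro borel_measurable_diff coordinate_measurable_completion \<tau>01) auto
      show "b i \<in> borel_measurable (completion \<mu>)" using i by (intro b_meas) simp
    qed
    then show ?thesis by (rule measurable_cong[THEN iffD1, rotated]) (simp add: G_\<xi>b)
  qed
  ultimately have "completion.expectation (\<lambda>w. \<phi> (grid_shift m w)) = completion.expectation (\<lambda>w. G (\<lambda>i\<in>{..<N}. \<xi> i w + a i w))"
    by (intro integral_cong_AE) auto
  also note main
  also have "completion.expectation (\<lambda>w. exp (G (\<lambda>i\<in>{..<N}. \<xi> i w))) = completion.expectation (\<lambda>w. exp (\<phi> w))"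
    by (intro Bochner_Integration.integral_cong) (auto simp: G_\<xi>)
  also have "(\<Sum>k<N. completion.expectation (\<lambda>w. (norm (a k w))\<^sup>2) / (2 * (1 / real N)))
      = real N / 2 * completion.expectation (\<lambda>w. \<Sum>k<N. (norm (b k w))\<^sup>2)"
    using b_int by (subst Bochner_Integration.integral_sum) (auto simp: a_exp sum_distrib_left field_simps intro!: sum.cong)
  also have "\<dots> \<le> real N / 2 * completion.expectation (\<lambda>w. cm_norm_sq (u w) / real N)"
    using b_int cm_norm_sq_integrable sum_b
    by (intro mult_left_mono integral_mono) auto
  also have "\<dots> = energy / 2" using N by (simp add: energy_def)
  finally show ?thesis by simp
qed

lemma grid_shift_measurable: "grid_shift m \<in> measurable (completion \<mu>) (\<Pi>\<^sub>M t\<in>{0..1}. borel)"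
  unfolding grid_shift_def
  by (intro measurable_restrict borel_measurable_add coordinate_measurable_completion u_measurable delayed_time)

proposition cylinder_inequality:
  assumes \<phi>: "cylinder_continuous n \<phi>"
  shows "completion.expectation (\<lambda>w. \<phi> (perturb u w))
    \<le> ln (completion.expectation (\<lambda>w. exp (\<phi> w))) + energy / 2"
proof (rule LIMSEQ_le_const2)
  obtain B where B: "\<And>w. \<bar>\<phi> w\<bar> \<le> B" using \<phi> unfolding cylinder_continuous_def by auto
  have \<phi>_meas[measurable]: "\<phi> \<in> borel_measurable (\<Pi>\<^sub>M t\<in>{0..1}. borel)"
    and \<phi>_cont: "\<And>X w. (\<And>t. t \<in> {0..1} \<Longrightarrow> (\<lambda>m. X m t) \<longlonglongrightarrow> w t) \<Longrightarrow> (\<lambda>m. \<phi> (X m)) \<longlonglongrightarrow> \<phi> w"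
    using \<phi> unfolding cylinder_continuous_def by blast+
  note grid_shift_measurable[measurable]
  have [measurable]: "perturb u \<in> measurable (completion \<mu>) (\<Pi>\<^sub>M t\<in>{0..1}. borel)"
    unfolding perturb_def[abs_def]
    by (intro measurable_restrict borel_measurable_add coordinate_measurable_completion u_measurable) auto
  show "(\<lambda>m. completion.expectation (\<lambda>w. \<phi> (grid_shift m w))) \<longlonglongrightarrow> completion.expectation (\<lambda>w. \<phi> (perturb u w))"
  proof (rule integral_dominated_convergence)
    show "integrable (completion \<mu>) (\<lambda>_. B)" by simp
    show "AE w in completion \<mu>. norm (\<phi> (grid_shift m w)) \<le> B" for m using B by simp
    show "AE w in completion \<mu>. (\<lambda>m. \<phi> (grid_shift m w)) \<longlonglongrightarrow> \<phi> (perturb u w)"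
    proof (intro AE_I2 \<phi>_cont)
      fix w and t :: real assume w: "w \<in> space (completion \<mu>)" and t: "t \<in> {0..1}"
      have "(\<lambda>m. max 0 (t - (1 / 2) ^ m)) \<longlonglongrightarrow> max 0 (t - 0)"
        by (intro tendsto_intros LIMSEQ_power_zero) auto
      then have "(\<lambda>m. max 0 (t - 1 / 2 ^ m)) \<longlonglongrightarrow> t" using t by (simp add: power_one_over)
      then have "(\<lambda>m. u w (max 0 (t - 1 / 2 ^ m))) \<longlonglongrightarrow> u w t"
        using w t u_continuous by (intro continuous_on_tendsto_compose[of "{0..1}" "u w"] always_eventually allI delayed_time) auto
      then show "(\<lambda>m. grid_shift m w t) \<longlonglongrightarrow> perturb u w t"
        using t by (auto simp: grid_shift_def perturb_def intro!: tendsto_intros)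
    qed
  qed measurable
  show "\<exists>M. \<forall>m\<ge>M. completion.expectation (\<lambda>w. \<phi> (grid_shift m w))
    \<le> ln (completion.expectation (\<lambda>w. exp (\<phi> w))) + energy / 2"
    using grid_shift_inequality[OF \<phi>] by blast
qed

end

section \<open>From cylinder functionals to the variational bound\<close>

text \<open>
  Follows from \<open>exp a - exp b = exp a * (1 - exp (b - a)) \<le> exp a * (a - b)\<close>.
\<close>
lemma exp_diff_le:
  fixes x y :: real
  assumes "x \<le> K" "y \<le> K" shows "\<bar>exp x - exp y\<bar> \<le> exp K * \<bar>x - y\<bar>"
proof -
  have *: "exp a - exp b \<le> exp K * \<bar>a - b\<bar>" if "a \<le> K" for a b :: real
  proof -
    have "exp a - exp b = exp a * (1 - exp (b - a))" by (simp add: exp_diff field_simps)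
    also have "\<dots> \<le> exp a * \<bar>a - b\<bar>"
      using exp_ge_add_one_self[of "b - a"] abs_ge_self[of "a - b"] by (intro mult_left_mono exp_ge_zero) linarith
    also have "\<dots> \<le> exp K * \<bar>a - b\<bar>" using that by (intro mult_right_mono) auto
    finally show ?thesis .
  qed
  show ?thesis using *[OF assms(1), of y] *[OF assms(2), of x] by (auto simp: abs_if)
qed

context adapted_shift
begin

abbreviation "shifted_law \<equiv> distr (completion \<mu>) \<mu> (perturb u)"

lemma wiener_measures_shifted: "wiener_measures \<mu> {\<mu>, shifted_law}"
proof (intro wiener_measures.intro wiener_measures_axioms.intro)
  show "wiener_measure \<mu>" by (rule wiener_measure_axioms)
  fix \<rho> assume "\<rho> \<in> {\<mu>, shifted_law}"
  then show "prob_space \<rho>" "sets \<rho> = sets \<mu>"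
    using prob_space_axioms completion.prob_space_distr[OF perturb_measurable] by auto
qed simp

text \<open>
  A cylinder functional that is close to \<open>g\<close> for both laws stays so after clamping to the range \<open>[- K, K]\<close>,
  on which the exponential function is Lipschitz. Hence both sides converge along such an approximating sequence.
\<close>
proposition bounded_inequality:
  assumes g[measurable]: "g \<in> borel_measurable \<mu>" and K: "\<And>w. \<bar>g w\<bar> \<le> K"
  shows "completion.expectation (\<lambda>w. g (perturb u w))
    \<le> ln (completion.expectation (\<lambda>w. exp (g w))) + energy / 2"
proof -
  interpret W: wiener_measures \<mu> "{\<mu>, shifted_law}" by (rule wiener_measures_shifted)
  note perturb_measurable[measurable]
  have "W.approximable g" by (rule W.bounded_approximable[OF g K])
  then have "\<forall>j. \<exists>n \<phi>. cylinder_continuous n \<phi> \<and> (\<integral>w. \<bar>g w - \<phi> w\<bar> \<partial>\<mu>) < inverse (real (Suc j))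
      \<and> (\<integral>w. \<bar>g w - \<phi> w\<bar> \<partial>shifted_law) < inverse (real (Suc j))"
    unfolding W.approximable_def by simp
  then have "\<exists>n \<phi>. \<forall>j. cylinder_continuous (n j) (\<phi> j) \<and> (\<integral>w. \<bar>g w - \<phi> j w\<bar> \<partial>\<mu>) < inverse (real (Suc j))
      \<and> (\<integral>w. \<bar>g w - \<phi> j w\<bar> \<partial>shifted_law) < inverse (real (Suc j))"
    by (simp only: choice_iff)
  then obtain n \<phi> where \<phi>: "\<And>j. cylinder_continuous (n j) (\<phi> j)"
    "\<And>j. (\<integral>w. \<bar>g w - \<phi> j w\<bar> \<partial>\<mu>) < inverse (real (Suc j))"
    "\<And>j. (\<integral>w. \<bar>g w - \<phi> j w\<bar> \<partial>shifted_law) < inverse (real (Suc j))"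
    by blast
  define \<psi> where "\<psi> j w = max (- K) (min K (\<phi> j w))" for j w
  have \<psi>: "cylinder_continuous (n j) (\<psi> j)" for j unfolding \<psi>_def[abs_def]
    by (rule cylinder_continuous_comp2[where h = "\<lambda>a _. max (- K) (min K a)", OF _ \<phi>(1) \<phi>(1)]) (intro continuous_intros)
  have \<psi>_meas[measurable]: "\<psi> j \<in> borel_measurable \<mu>" for j using \<psi> by (rule W.cylinder_measurable)
  have K0: "K \<ge> 0" using K[of undefined] by simp
  have \<psi>K: "\<bar>\<psi> j w\<bar> \<le> K" for j w using K0 by (auto simp: \<psi>_def)
  have \<psi>_le: "\<bar>g w - \<psi> j w\<bar> \<le> \<bar>g w - \<phi> j w\<bar>" for j w using K[of w] by (auto simp: \<psi>_def)
  have \<psi>_close: "(\<integral>w. \<bar>g w - \<psi> j w\<bar> \<partial>\<rho>) \<le> inverse (real (Suc j))" if "\<rho> \<in> {\<mu>, shifted_law}" for j \<rho>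
  proof -
    have "(\<integral>w. \<bar>g w - \<psi> j w\<bar> \<partial>\<rho>) \<le> (\<integral>w. \<bar>g w - \<phi> j w\<bar> \<partial>\<rho>)"
    proof (rule integral_mono')
      show "integrable \<rho> (\<lambda>w. \<bar>g w - \<phi> j w\<bar>)"
        by (intro integrable_abs Bochner_Integration.integrable_diff W.R_integrable[OF that g K] W.cylinder_integrable[OF that \<phi>(1)])
    qed (use \<psi>_le in auto)
    also have "\<dots> \<le> inverse (real (Suc j))" using \<phi>(2,3)[of j] that by auto
    finally show ?thesis .
  qed
  have left: "(\<lambda>j. completion.expectation (\<lambda>w. \<psi> j (perturb u w))) \<longlonglongrightarrow> completion.expectation (\<lambda>w. g (perturb u w))"
  proof (rule LIM_zero_cancel, rule Lim_null_comparison[OF _ LIMSEQ_inverse_real_of_nat], intro always_eventually allI)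
    fix j
    have i: "integrable shifted_law (\<psi> j)" "integrable shifted_law g"
      by (auto intro!: W.R_integrable \<psi>K K)
    have "completion.expectation (\<lambda>w. \<psi> j (perturb u w)) - completion.expectation (\<lambda>w. g (perturb u w))
        = (\<integral>w. \<psi> j w - g w \<partial>shifted_law)"
      using i by (simp add: integral_distr)
    then have "norm (completion.expectation (\<lambda>w. \<psi> j (perturb u w)) - completion.expectation (\<lambda>w. g (perturb u w)))
        \<le> (\<integral>w. norm (\<psi> j w - g w) \<partial>shifted_law)" by (simp only: integral_norm_bound)
    also have "\<dots> \<le> inverse (real (Suc j))" using \<psi>_close[of shifted_law j] by (simp add: abs_minus_commute)
    finally show "norm (completion.expectation (\<lambda>w. \<psi> j (perturb u w)) - completion.expectation (\<lambda>w. g (perturb u w)))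
        \<le> inverse (real (Suc j))" .
  qed
  have mgf: "(\<lambda>j. completion.expectation (\<lambda>w. exp (\<psi> j w))) \<longlonglongrightarrow> completion.expectation (\<lambda>w. exp (g w))"
  proof (rule LIM_zero_cancel, rule Lim_null_comparison, intro always_eventually allI)
    show "(\<lambda>j. exp K * inverse (real (Suc j))) \<longlonglongrightarrow> 0"
      using tendsto_mult_right_zero[OF LIMSEQ_inverse_real_of_nat] by simp
    fix j
    have i: "integrable \<mu> (\<lambda>w. exp (\<psi> j w))" "integrable \<mu> (\<lambda>w. exp (g w))"
      using \<psi>K[of j] K by (auto intro!: W.R_integrable[where K = "exp K"] simp: abs_le_iff)
    have i': "integrable \<mu> (\<lambda>w. \<bar>g w - \<psi> j w\<bar>)"
      by (intro integrable_abs Bochner_Integration.integrable_diff W.R_integrable[OF _ g K] W.cylinder_integrable[OF _ \<psi>]) auto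
    have "completion.expectation (\<lambda>w. exp (\<psi> j w)) - completion.expectation (\<lambda>w. exp (g w))
        = (\<integral>w. exp (\<psi> j w) - exp (g w) \<partial>\<mu>)"
      using i by (simp add: integral_completion)
    then have "norm (completion.expectation (\<lambda>w. exp (\<psi> j w)) - completion.expectation (\<lambda>w. exp (g w)))
        \<le> (\<integral>w. norm (exp (\<psi> j w) - exp (g w)) \<partial>\<mu>)" by (simp only: integral_norm_bound)
    also have "\<dots> \<le> (\<integral>w. exp K * \<bar>g w - \<psi> j w\<bar> \<partial>\<mu>)"
    proof (rule integral_mono')
      show "norm (exp (\<psi> j w) - exp (g w)) \<le> exp K * \<bar>g w - \<psi> j w\<bar>" for w
        using exp_diff_le[of "\<psi> j w" K "g w"] \<psi>K[of j w] K[of w] by (simp add: abs_minus_commute abs_le_iff)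
    qed (use i' in auto)
    also have "\<dots> \<le> exp K * inverse (real (Suc j))" using \<psi>_close[of \<mu> j] by simp
    finally show "norm (completion.expectation (\<lambda>w. exp (\<psi> j w)) - completion.expectation (\<lambda>w. exp (g w)))
        \<le> exp K * inverse (real (Suc j))" .
  qed
  have "exp (- K) \<le> completion.expectation (\<lambda>w. exp (g w))"
    using K by (intro completion.expectation_exp_ge measurable_completion g) auto
  then have pos: "completion.expectation (\<lambda>w. exp (g w)) > 0"
    by (rule order.strict_trans2[OF exp_gt_zero])
  have "(\<lambda>j. ln (completion.expectation (\<lambda>w. exp (\<psi> j w))) + energy / 2) \<longlonglongrightarrow>
      ln (completion.expectation (\<lambda>w. exp (g w))) + energy / 2"
    using pos by (intro tendsto_intros mgf) auto
  from LIMSEQ_le[OF left this] show ?thesis using cylinder_inequality[OF \<psi>] by blast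
qed

text \<open>
  For \<open>g = n * indicator N\<close> the exponential moment under Wiener measure is one, so \<open>n\<close> times the
  probability of \<open>N\<close> under the shifted law is at most half the energy, for every \<open>n\<close>.
\<close>
lemma AE_perturb_not_in_null_set:
  assumes N: "N \<in> null_sets \<mu>"
  shows "AE w in completion \<mu>. perturb u w \<notin> N"
proof -
  have N_sets[measurable]: "N \<in> sets \<mu>" using N by auto
  note perturb_measurable[measurable]
  let ?E = "perturb u -` N \<inter> space (completion \<mu>)"
  have E: "?E \<in> sets (completion \<mu>)" by (rule measurable_sets[OF perturb_measurable N_sets])
  have "real n * completion.prob ?E \<le> energy / 2" for n
  proof -
    have "AE w in completion \<mu>. exp (real n * indicator N w) = 1"
      using AE_completion[OF AE_not_in[OF N]] by eventually_elim simp
    then have one: "completion.expectation (\<lambda>w. exp (real n * indicator N w)) = completion.expectation (\<lambda>w. 1)"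
      by (intro integral_cong_AE measurable_completion) auto
    have "real n * completion.prob ?E = completion.expectation (\<lambda>w. real n * indicator ?E w)"
      using E by simp
    also have "\<dots> = completion.expectation (\<lambda>w. real n * indicator N (perturb u w))"
      by (intro Bochner_Integration.integral_cong) (auto simp: indicator_def)
    also have "\<dots> \<le> ln (completion.expectation (\<lambda>w. exp (real n * indicator N w))) + energy / 2"
      by (rule bounded_inequality[where K = "real n"]) (auto simp: indicator_def)
    also have "\<dots> = energy / 2" unfolding one by (simp add: prob_space)
    finally show ?thesis .
  qed
  then have "completion.prob ?E \<le> 0"
    by (metis linorder_not_less reals_Archimedean3)
  then have "completion.prob ?E = 0" using measure_nonneg[of "completion \<mu>" ?E] by linarith
  then have "?E \<in> null_sets (completion \<mu>)" using E by (simp add: null_sets_def completion.emeasure_eq_measure)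
  from AE_not_in[OF this] AE_space show ?thesis by eventually_elim auto
qed

text \<open>
  The bounded inequality for \<open>min n (max 0 (- f))\<close> bounds the integral of the negative part of the shifted
  functional, uniformly in \<open>n\<close>, by \<open>ln (E[exp (- f)] + 1)\<close> plus half the energy. So the expectation on the right
  is well defined. It is either infinite, or the shifted functional is integrable and the bounded inequality for
  \<open>- f\<close> clamped to \<open>[- n, n]\<close> passes to the limit by dominated convergence.
\<close>
lemma variational_lower_bound:
  assumes f[measurable]: "f \<in> borel_measurable \<mu>" and int: "integrable (completion \<mu>) (\<lambda>w. exp (- f w))"
  shows "ereal (- ln (completion.expectation (\<lambda>w. exp (- f w))))
    \<le> ext_expectation (completion \<mu>) (\<lambda>w. f (perturb u w) + 1 / 2 * cm_norm_sq (u w))"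
proof -
  note perturb_measurable[measurable]
  have fm[measurable]: "f \<in> borel_measurable (completion \<mu>)" by (rule measurable_completion) (rule f)
  have cm_meas[measurable]: "(\<lambda>w. cm_norm_sq (u w)) \<in> borel_measurable (completion \<mu>)"
    using cm_norm_sq_integrable by (rule borel_measurable_integrable)
  let ?Z = "completion.expectation (\<lambda>w. exp (- f w))"
  let ?X = "\<lambda>w. f (perturb u w) + 1 / 2 * cm_norm_sq (u w)"
  have Z: "?Z > 0" by (rule completion.expectation_greater[OF int]) simp
  define D where "D = ln (?Z + 1) + energy / 2"
  have neg_finite: "(\<integral>\<^sup>+w. ennreal (- f (perturb u w)) \<partial>completion \<mu>) \<le> ennreal D"
  proof (rule LIMSEQ_le_const2)
    define g where "g n w = min (real n) (max 0 (- f w))" for n :: nat and w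
    have g_meas[measurable]: "g n \<in> borel_measurable \<mu>" for n unfolding g_def by measurable
    have g_bound: "\<bar>g n w\<bar> \<le> real n" for n w by (simp add: g_def)
    have g_nonneg: "0 \<le> g n w" for n w by (simp add: g_def)
    show "(\<lambda>n. \<integral>\<^sup>+w. ennreal (g n (perturb u w)) \<partial>completion \<mu>) \<longlonglongrightarrow> (\<integral>\<^sup>+w. ennreal (- f (perturb u w)) \<partial>completion \<mu>)"
    proof (rule nn_integral_LIMSEQ)
      show "incseq (\<lambda>n w. ennreal (g n (perturb u w)))"
        by (auto simp: incseq_def le_fun_def g_def intro!: ennreal_leI)
      fix w
      obtain N where N: "- f (perturb u w) \<le> real N" using real_arch_simple by blast
      have "ennreal (g n (perturb u w)) = ennreal (- f (perturb u w))" if "n \<ge> N" for n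
      proof (cases "0 \<le> - f (perturb u w)")
        case True
        then show ?thesis using N that by (simp add: g_def)
      next
        case False
        then show ?thesis by (simp add: g_def ennreal_neg)
      qed
      then show "(\<lambda>n. ennreal (g n (perturb u w))) \<longlonglongrightarrow> ennreal (- f (perturb u w))"
        by (intro tendsto_eventually eventually_sequentiallyI[of N])
    qed measurable
    have "(\<integral>\<^sup>+w. ennreal (g n (perturb u w)) \<partial>completion \<mu>) \<le> ennreal D" for n
    proof -
      have gi: "integrable (completion \<mu>) (\<lambda>w. g n (perturb u w))"
        by (rule completion.integrable_const_bound[of _ "real n"]) (use g_bound in auto)
      have ei: "integrable (completion \<mu>) (\<lambda>w. exp (g n w))"
        by (rule completion.integrable_const_bound[of _ "exp (real n)"])
          (use g_bound[of n] in \<open>auto intro: measurable_completion simp: abs_le_iff\<close>)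
      have "(\<integral>\<^sup>+w. ennreal (g n (perturb u w)) \<partial>completion \<mu>) = ennreal (completion.expectation (\<lambda>w. g n (perturb u w)))"
        by (rule nn_integral_eq_integral[OF gi]) (simp add: g_nonneg)
      also have "\<dots> \<le> ennreal D"
      proof (rule ennreal_leI)
        have "completion.expectation (\<lambda>w. g n (perturb u w)) \<le> ln (completion.expectation (\<lambda>w. exp (g n w))) + energy / 2"
          by (rule bounded_inequality[OF g_meas g_bound])
        moreover have "ln (completion.expectation (\<lambda>w. exp (g n w))) \<le> ln (?Z + 1)"
        proof (rule ln_mono)
          show "0 < completion.expectation (\<lambda>w. exp (g n w))"
            by (rule completion.expectation_greater[OF ei]) simp
          have "completion.expectation (\<lambda>w. exp (g n w)) \<le> completion.expectation (\<lambda>w. exp (- f w) + 1)"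
          proof (rule integral_mono[OF ei])
            show "exp (g n w) \<le> exp (- f w) + 1" for w
            proof (cases "f w \<le> 0")
              case True
              then have "exp (g n w) \<le> exp (- f w)" by (simp add: g_def)
              then show ?thesis by linarith
            next
              case False
              then have "g n w = 0" by (simp add: g_def)
              then show ?thesis by simp
            qed
          qed (use int in simp)
          then show "completion.expectation (\<lambda>w. exp (g n w)) \<le> ?Z + 1"
            using int by (simp add: prob_space)
        qed
        ultimately show "completion.expectation (\<lambda>w. g n (perturb u w)) \<le> D" by (simp add: D_def)
      qed
      finally show ?thesis .
    qed
    then show "\<exists>N. \<forall>n\<ge>N. (\<integral>\<^sup>+w. ennreal (g n (perturb u w)) \<partial>completion \<mu>) \<le> ennreal D" by blast
  qed
  have "(\<integral>\<^sup>+w. ennreal (- ?X w) \<partial>completion \<mu>) \<le> (\<integral>\<^sup>+w. ennreal (- f (perturb u w)) \<partial>completion \<mu>)"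
    by (intro nn_integral_mono ennreal_leI) (simp add: cm_norm_sq_nonneg)
  also note neg_finite
  finally have X_neg: "(\<integral>\<^sup>+w. ennreal (- ?X w) \<partial>completion \<mu>) \<noteq> \<infinity>"
    by (auto simp: top_unique)
  show ?thesis
  proof (cases "(\<integral>\<^sup>+w. ennreal (?X w) \<partial>completion \<mu>) = \<infinity>")
    case True
    then have "ext_expectation (completion \<mu>) ?X = \<infinity>"
      using X_neg unfolding ext_expectation_def by (cases "\<integral>\<^sup>+w. ennreal (- ?X w) \<partial>completion \<mu>") (auto simp: enn2ereal_ennreal)
    then show ?thesis by simp
  next
    case False
    have X_int: "integrable (completion \<mu>) ?X"
      unfolding real_integrable_def using False X_neg by auto
    have "ext_expectation (completion \<mu>) ?X = ereal (completion.expectation ?X)"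
      unfolding real_lebesgue_integral_def[OF X_int] ext_expectation_def using False X_neg
      by (cases "\<integral>\<^sup>+w. ennreal (- ?X w) \<partial>completion \<mu>"; cases "\<integral>\<^sup>+w. ennreal (?X w) \<partial>completion \<mu>")
        (auto simp: enn2ereal_ennreal)
    moreover have f_int: "integrable (completion \<mu>) (\<lambda>w. f (perturb u w))"
      using Bochner_Integration.integrable_diff[OF X_int integrable_mult_right[OF cm_norm_sq_integrable, of "1 / 2"]] by simp
    moreover have "completion.expectation ?X = completion.expectation (\<lambda>w. f (perturb u w)) + energy / 2"
      using f_int cm_norm_sq_integrable by (simp add: energy_def)
    moreover have "completion.expectation (\<lambda>w. - f (perturb u w)) \<le> ln ?Z + energy / 2"
    proof (rule LIMSEQ_le)
      define g where "g n w = max (- real n) (min (real n) (- f w))" for n :: nat and w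
      have g_meas[measurable]: "g n \<in> borel_measurable \<mu>" for n unfolding g_def by measurable
      have g_meas'[measurable]: "g n \<in> borel_measurable (completion \<mu>)" for n by (rule measurable_completion) (rule g_meas)
      have g_bound: "\<bar>g n w\<bar> \<le> real n" for n w by (auto simp: g_def)
      have g_lim: "(\<lambda>n. g n w) \<longlonglongrightarrow> - f w" for w
      proof -
        obtain N where N: "\<bar>f w\<bar> \<le> real N" using real_arch_simple by blast
        then have "g n w = - f w" if "n \<ge> N" for n using that by (auto simp: g_def)
        then show ?thesis by (intro tendsto_eventually eventually_sequentiallyI[of N])
      qed
      show "(\<lambda>n. completion.expectation (\<lambda>w. g n (perturb u w))) \<longlonglongrightarrow> completion.expectation (\<lambda>w. - f (perturb u w))"
      proof (rule integral_dominated_convergence)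
        show "integrable (completion \<mu>) (\<lambda>w. \<bar>f (perturb u w)\<bar>)" using f_int by (rule integrable_abs)
        show "AE w in completion \<mu>. norm (g n (perturb u w)) \<le> \<bar>f (perturb u w)\<bar>" for n
          by (intro AE_I2) (auto simp: g_def)
        show "AE w in completion \<mu>. (\<lambda>n. g n (perturb u w)) \<longlonglongrightarrow> - f (perturb u w)" using g_lim by simp
      qed measurable
      have "(\<lambda>n. completion.expectation (\<lambda>w. exp (g n w))) \<longlonglongrightarrow> ?Z"
      proof (rule integral_dominated_convergence)
        show "integrable (completion \<mu>) (\<lambda>w. exp (- f w) + 1)" using int by simp
        show "AE w in completion \<mu>. norm (exp (g n w)) \<le> exp (- f w) + 1" for n
        proof (intro AE_I2)
          fix w
          show "norm (exp (g n w)) \<le> exp (- f w) + 1"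
          proof (cases "f w \<le> 0")
            case True
            then have "exp (g n w) \<le> exp (- f w)" by (simp add: g_def)
            then show ?thesis unfolding real_norm_def abs_exp_cancel by linarith
          next
            case False
            then have "exp (g n w) \<le> exp 0" unfolding exp_le_cancel_iff by (simp add: g_def)
            then show ?thesis using exp_gt_zero[of "- f w"] unfolding real_norm_def abs_exp_cancel exp_zero by linarith
          qed
        qed
        show "AE w in completion \<mu>. (\<lambda>n. exp (g n w)) \<longlonglongrightarrow> exp (- f w)" using g_lim by (intro AE_I2 tendsto_intros)
      qed measurable
      then show "(\<lambda>n. ln (completion.expectation (\<lambda>w. exp (g n w))) + energy / 2) \<longlonglongrightarrow> ln ?Z + energy / 2"
        using Z by (intro tendsto_intros) auto
      show "\<exists>N. \<forall>n\<ge>N. completion.expectation (\<lambda>w. g n (perturb u w)) \<le> ln (completion.expectation (\<lambda>w. exp (g n w))) + energy / 2"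
        using bounded_inequality[OF g_meas g_bound] by blast
    qed
    ultimately show ?thesis by simp
  qed
qed

end

text \<open>
  Since the shifted law is absolutely continuous, \<open>f\<close> may be replaced by a Borel version on both sides.
\<close>
theorem theorem6:
  fixes \<mu> :: "(real \<Rightarrow> real ^ 'd::finite) measure"
    and f :: "(real \<Rightarrow> real ^ 'd) \<Rightarrow> real"
  assumes "wiener_measure \<mu>"
    and "f \<in> borel_measurable (completion \<mu>)"
    and "integrable (completion \<mu>) (\<lambda>w. (\<bar>f w\<bar> + 1) * exp (- f w))"
  shows "ereal (- ln (LINT w|completion \<mu>. exp (- f w)))
    \<le> (INF u \<in> L2_adapted \<mu>.
         ext_expectation (completion \<mu>) (\<lambda>w. f (perturb u w) + 1 / 2 * cm_norm_sq (u w)))"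
proof (rule INF_greatest)
  fix u assume u: "u \<in> L2_adapted \<mu>"
  interpret wiener_measure \<mu> by fact
  interpret adapted_shift \<mu> u by unfold_locales (rule u)
  note assms(2)[measurable]
  obtain f' where f'[measurable]: "f' \<in> borel_measurable \<mu>" and eq: "AE w in \<mu>. f w = f' w"
    using completion_ex_borel_measurable_real[OF assms(2)] by blast
  have f'c[measurable]: "f' \<in> borel_measurable (completion \<mu>)" by (rule measurable_completion) (rule f')
  obtain N where N: "\<And>w. w \<in> space \<mu> - N \<Longrightarrow> f w = f' w" "N \<in> null_sets \<mu>"
    by (rule AE_E3[OF eq]) blast
  have eq_shift: "AE w in completion \<mu>. f (perturb u w) = f' (perturb u w)"
    using AE_perturb_not_in_null_set[OF N(2)] AE_space
  proof eventually_elim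
    case (elim w)
    have "perturb u w \<in> space \<mu>" using perturb_measurable elim(2) by (rule measurable_space)
    then show ?case using elim(1) by (intro N(1)) simp
  qed
  have int: "integrable (completion \<mu>) (\<lambda>w. exp (- f w))"
  proof (rule Bochner_Integration.integrable_bound[OF assms(3)], goal_cases)
    case 2
    have "1 * exp (- f w) \<le> (\<bar>f w\<bar> + 1) * exp (- f w)" for w by (rule mult_right_mono) auto
    then show ?case by (intro AE_I2) simp
  qed simp
  have eq': "AE w in completion \<mu>. exp (- f w) = exp (- f' w)"
    using AE_completion[OF eq] by eventually_elim simp
  have Z: "(LINT w|completion \<mu>. exp (- f w)) = (LINT w|completion \<mu>. exp (- f' w))"
    by (rule integral_cong_AE) (use eq' in auto)
  have "integrable (completion \<mu>) (\<lambda>w. exp (- f' w))"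
    using int by (subst (asm) integrable_cong_AE[OF _ _ eq']) auto
  from variational_lower_bound[OF f' this]
  have "ereal (- ln (LINT w|completion \<mu>. exp (- f w)))
      \<le> ext_expectation (completion \<mu>) (\<lambda>w. f' (perturb u w) + 1 / 2 * cm_norm_sq (u w))"
    unfolding Z .
  also have "\<dots> = ext_expectation (completion \<mu>) (\<lambda>w. f (perturb u w) + 1 / 2 * cm_norm_sq (u w))"
  proof -
    have "(\<integral>\<^sup>+w. ennreal (f' (perturb u w) + 1 / 2 * cm_norm_sq (u w)) \<partial>completion \<mu>)
        = (\<integral>\<^sup>+w. ennreal (f (perturb u w) + 1 / 2 * cm_norm_sq (u w)) \<partial>completion \<mu>)"
      using eq_shift by (intro nn_integral_cong_AE) (auto elim!: eventually_mono)
    moreover have "(\<integral>\<^sup>+w. ennreal (- (f' (perturb u w) + 1 / 2 * cm_norm_sq (u w))) \<partial>completion \<mu>)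
        = (\<integral>\<^sup>+w. ennreal (- (f (perturb u w) + 1 / 2 * cm_norm_sq (u w))) \<partial>completion \<mu>)"
      using eq_shift by (intro nn_integral_cong_AE) (auto elim!: eventually_mono)
    ultimately show ?thesis unfolding ext_expectation_def by simp
  qed
  finally show "ereal (- ln (LINT w|completion \<mu>. exp (- f w)))
      \<le> ext_expectation (completion \<mu>) (\<lambda>w. f (perturb u w) + 1 / 2 * cm_norm_sq (u w))" .
qed

end
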